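(* Let $\mathcal{M}$ be a convex subring of $^*\mathbb{C}$ and let $\Omega$ be an arcwise connected (non-empty) open subset of $\mathbb{R}^d$. Then, identifying $\widehat{c}\in\widehat{\mathcal{M}}$ with the class $\widehat{f_c}\in\widehat{\mathcal{M}}(\Omega)$ of the constant function $f_c(x)=c$ ($x\in{}^*\Omega$, $c\in\mathcal{M}$), one has $$\widehat{\mathcal{M}}=\{\widehat{f}\in\widehat{\mathcal{M}}(\Omega): \nabla\widehat{f}=0\}.$$ That is, $\widehat{c}\mapsto\widehat{f_c}$ is a well-defined injection of $\widehat{\mathcal{M}}$ into $\widehat{\mathcal{M}}(\Omega)$ whose range is the set of all $\widehat{f}$ with zero gradient. In particular, $\widehat{\mathcal{M}}=\{\widehat{f}\in\widehat{\mathcal{M}}(\mathbb{R}^d): \nabla\widehat{f}=0\}$.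
   Context: Let $\mathcal{I}$ be an infinite set, $\mathcal{U}$ an ultrafilter on $\mathcal{I}$ containing a decreasing sequence of sets with empty intersection (and $\kappa$-good, $\kappa=\mathrm{card}(\mathcal{I})$, if $\mathcal{I}$ is uncountable). For a set $S$, $^*S=S^{\mathcal{I}}/\mathcal{U}$, with $\langle s_i\rangle$ the class of $(s_i)$. Rings have an identity and subrings contain it. A subring $\mathcal{M}$ of $^*\mathbb{C}$ is convex if for all $z\in{}^*\mathbb{C}$, $\zeta\in\mathcal{M}$, $|z|\le|\zeta|$ implies $z\in\mathcal{M}$; $\mathcal{M}_0=\{z\in\mathcal{M}: z=0\text{ or }1/z\notin\mathcal{M}\}$ is its maximal ideal and $\widehat{\mathcal{M}}=\mathcal{M}/\mathcal{M}_0$. For $\Omega\subseteq\mathbb{R}^d$ open, $\mathcal{E}(\Omega)=C^\infty(\Omega)$ (complex-valued) and elements $\langle f_i\rangle$ of $^*\mathcal{E}(\Omega)=\mathcal{E}(\Omega)^{\mathcal{I}}/\mathcal{U}$ are viewed as functions $^*\Omega\to{}^*\mathbb{C}$, $\langle f_i\rangle(\langle x_i\rangle)=\langle f_i(x_i)\rangle$, with $\partial^\alpha\langle f_i\rangle=\langle\partial^\alpha f_i\rangle$. The monad of $\Omega$ is $\mu(\Omega)=\{r+h: r\in\Omega, h\in{}^*\mathbb{R}^d, \|h\|\text{ infinitesimal}\}\subseteq{}^*\Omega$. Put $\mathcal{M}(\Omega)=\{f\in{}^*\mathcal{E}(\Omega):\partial^\alpha f(x)\in\mathcal{M}\ \forall\alpha\in\mathbb{N}_0^d,\forall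 x\in\mu(\Omega)\}$, $\mathcal{M}_0(\Omega)=\{f\in{}^*\mathcal{E}(\Omega):\partial^\alpha f(x)\in\mathcal{M}_0\ \forall\alpha\in\mathbb{N}_0^d,\forall x\in\mu(\Omega)\}$, and $\widehat{\mathcal{M}}(\Omega)=\mathcal{M}(\Omega)/\mathcal{M}_0(\Omega)$, a differential ring with $\partial^\alpha\widehat{f}=\widehat{\partial^\alpha f}$, where $\widehat f$ is the class of $f$. *)

theory Defs
  imports "HOL-Analysis.Analysis" "HOL-Library.Equipollence"
    "HOL-Algebra.Subrings" "HOL-Algebra.QuotRing"
begin

section \<open>The ultrafilter\<close>

text \<open>The index set is the universe of the type variable \<open>'i\<close>; a set \<open>A\<close> of indices belongs to
  the filter \<open>U\<close> iff \<open>\<forall>\<^sub>F i in U. i \<in> A\<close>.\<close>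

definition ultrafilter :: "'i filter \<Rightarrow> bool" where
  "ultrafilter U \<longleftrightarrow> U \<noteq> bot \<and> (\<forall>P. eventually P U \<or> eventually (\<lambda>i. \<not> P i) U)"

text \<open>Goodness for the cardinal of the set \<open>K\<close>: for every cardinal \<open>\<beta> < card K\<close>
  (realised by some \<open>G \<subseteq> K\<close>), each order-reversing map from the finite subsets of \<open>G\<close> to the filter
  is refined by one that turns unions into intersections.\<close>

definition good_filter :: "'k set \<Rightarrow> 'i filter \<Rightarrow> bool" where
  "good_filter K U \<longleftrightarrow>
    (\<forall>G \<subseteq> K. G \<prec> K \<longrightarrow>
      (\<forall>R :: 'k set \<Rightarrow> 'i set.
        (\<forall>X \<in> Fpow G. \<forall>\<^sub>F i in U. i \<in> R X) \<and>
        (\<forall>X \<in> Fpow G. \<forall>Y \<in> Fpow G. X \<subseteq> Y \<longrightarrow> R Y \<subseteq> R X) \<longrightarrow>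
        (\<exists>S :: 'k set \<Rightarrow> 'i set.
          (\<forall>X \<in> Fpow G. \<forall>\<^sub>F i in U. i \<in> S X) \<and>
          (\<forall>X \<in> Fpow G. \<forall>Y \<in> Fpow G. S (X \<union> Y) = S X \<inter> S Y) \<and>
          (\<forall>X \<in> Fpow G. S X \<subseteq> R X))))"


section \<open>Ultrapowers\<close>

text \<open>The class of \<open>s\<close> is taken among all families in the ambient type. In this way the
  nonstandard extension of a subset of \<open>T\<close> is literally a subset of that of \<open>T\<close>; for example, the
  extension of a set of points is a subset of the extension of the whole Euclidean space.\<close>

definition star_class :: "'i filter \<Rightarrow> ('i \<Rightarrow> 'a) \<Rightarrow> ('i \<Rightarrow> 'a) set" where
  "star_class U s = {t. \<forall>\<^sub>F i in U. t i = s i}"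

definition star :: "'i filter \<Rightarrow> 'a set \<Rightarrow> ('i \<Rightarrow> 'a) set set" where
  "star U S = {star_class U s | s. \<forall>i. s i \<in> S}"

definition star_of :: "'i filter \<Rightarrow> 'a \<Rightarrow> ('i \<Rightarrow> 'a) set" where
  "star_of U a = star_class U (\<lambda>_. a)"

text \<open>Operations and relations act on representatives. The unions below are unions of a single
  class repeated, since the result does not depend on the representatives.\<close>

definition star_map :: "'i filter \<Rightarrow> ('a \<Rightarrow> 'b) \<Rightarrow> ('i \<Rightarrow> 'a) set \<Rightarrow> ('i \<Rightarrow> 'b) set" where
  "star_map U g X = (\<Union>s\<in>X. star_class U (\<lambda>i. g (s i)))"

definition star_map2 ::
  "'i filter \<Rightarrow> ('a \<Rightarrow> 'b \<Rightarrow> 'c) \<Rightarrow> ('i \<Rightarrow> 'a) set \<Rightarrow> ('i \<Rightarrow> 'b) set \<Rightarrow> ('i \<Rightarrow> 'c) set" where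
  "star_map2 U g X Y = (\<Union>s\<in>X. \<Union>t\<in>Y. star_class U (\<lambda>i. g (s i) (t i)))"

definition star_pred2 ::
  "'i filter \<Rightarrow> ('a \<Rightarrow> 'b \<Rightarrow> bool) \<Rightarrow> ('i \<Rightarrow> 'a) set \<Rightarrow> ('i \<Rightarrow> 'b) set \<Rightarrow> bool" where
  "star_pred2 U P X Y \<longleftrightarrow> (\<exists>s\<in>X. \<exists>t\<in>Y. \<forall>\<^sub>F i in U. P (s i) (t i))"

lemma star_class_refl: "s \<in> star_class U s"
  by (simp add: star_class_def)

lemma star_class_eq_iff: "star_class U s = star_class U t \<longleftrightarrow> (\<forall>\<^sub>F i in U. s i = t i)"
proof
  assume "star_class U s = star_class U t"
  then show "\<forall>\<^sub>F i in U. s i = t i"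
    using star_class_refl[of s U] by (simp add: star_class_def)
next
  assume *: "\<forall>\<^sub>F i in U. s i = t i"
  have "(\<forall>\<^sub>F i in U. u i = s i) \<longleftrightarrow> (\<forall>\<^sub>F i in U. u i = t i)" for u
    by (rule eventually_subst, rule eventually_mono[OF *]) simp
  then show "star_class U s = star_class U t"
    by (auto simp: star_class_def)
qed

lemma star_map_class: "star_map U g (star_class U s) = star_class U (\<lambda>i. g (s i))"
proof -
  have *: "star_class U (\<lambda>i. g (u i)) = star_class U (\<lambda>i. g (s i))" if "u \<in> star_class U s" for u
  proof -
    have "\<forall>\<^sub>F i in U. u i = s i"
      using that by (simp_all add: star_class_def)
    then show ?thesis
      unfolding star_class_eq_iff by eventually_elim simp
  qed
  have "star_map U g (star_class U s) =
      (\<Union>u\<in>star_class U s. star_class U (\<lambda>i. g (s i)))"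
    unfolding star_map_def by (intro SUP_cong refl *)
  then show ?thesis
    using star_class_refl[of s U] by blast
qed

lemma star_map2_class:
  "star_map2 U g (star_class U s) (star_class U t) = star_class U (\<lambda>i. g (s i) (t i))"
proof -
  have *: "star_class U (\<lambda>i. g (u i) (v i)) = star_class U (\<lambda>i. g (s i) (t i))"
    if "u \<in> star_class U s" "v \<in> star_class U t" for u v
  proof -
    have "\<forall>\<^sub>F i in U. u i = s i" "\<forall>\<^sub>F i in U. v i = t i"
      using that by (simp_all add: star_class_def)
    then show ?thesis
      unfolding star_class_eq_iff by eventually_elim simp
  qed
  have "star_map2 U g (star_class U s) (star_class U t) =
      (\<Union>u\<in>star_class U s. \<Union>v\<in>star_class U t. star_class U (\<lambda>i. g (s i) (t i)))"
    unfolding star_map2_def by (intro SUP_cong refl *)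
  then show ?thesis
    using star_class_refl[of s U] star_class_refl[of t U] by blast
qed

lemma star_pred2_class:
  "star_pred2 U P (star_class U s) (star_class U t) \<longleftrightarrow> (\<forall>\<^sub>F i in U. P (s i) (t i))"
proof
  assume "star_pred2 U P (star_class U s) (star_class U t)"
  then obtain u v where "\<forall>\<^sub>F i in U. u i = s i" "\<forall>\<^sub>F i in U. v i = t i" "\<forall>\<^sub>F i in U. P (u i) (v i)"
    by (auto simp: star_pred2_def star_class_def)
  then show "\<forall>\<^sub>F i in U. P (s i) (t i)"
    by eventually_elim simp
next
  assume "\<forall>\<^sub>F i in U. P (s i) (t i)"
  then show "star_pred2 U P (star_class U s) (star_class U t)"
    unfolding star_pred2_def by (intro bexI[of _ s] bexI[of _ t] star_class_refl)
qed

definition star_ring :: "'i filter \<Rightarrow> 'a ring \<Rightarrow> ('i \<Rightarrow> 'a) set ring" where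
  "star_ring U R =
    \<lparr>carrier = star U (carrier R), mult = star_map2 U (mult R), one = star_of U \<one>\<^bsub>R\<^esub>,
     zero = star_of U \<zero>\<^bsub>R\<^esub>, add = star_map2 U (add R)\<rparr>"


section \<open>Convex subrings of the nonstandard complex numbers\<close>

definition complex_ring :: "complex ring" where
  "complex_ring = \<lparr>carrier = UNIV, mult = (*), one = 1, zero = 0, add = (+)\<rparr>"

abbreviation starC :: "'i filter \<Rightarrow> ('i \<Rightarrow> complex) set ring" where
  "starC U \<equiv> star_ring U complex_ring"

definition convex_subring :: "'i filter \<Rightarrow> ('i \<Rightarrow> complex) set set \<Rightarrow> bool" where
  "convex_subring U M \<longleftrightarrow> subring M (starC U) \<and>
    (\<forall>z \<in> carrier (starC U). \<forall>\<zeta> \<in> M.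
      star_pred2 U (\<le>) (star_map U norm z) (star_map U norm \<zeta>) \<longrightarrow> z \<in> M)"

definition M0 :: "'i filter \<Rightarrow> ('i \<Rightarrow> complex) set set \<Rightarrow> ('i \<Rightarrow> complex) set set" where
  "M0 U M = {z \<in> M. z = \<zero>\<^bsub>starC U\<^esub> \<or> inv\<^bsub>starC U\<^esub> z \<notin> M}"

definition Mhat :: "'i filter \<Rightarrow> ('i \<Rightarrow> complex) set set \<Rightarrow> ('i \<Rightarrow> complex) set set ring" where
  "Mhat U M = (starC U)\<lparr>carrier := M\<rparr> Quot M0 U M"

definition hat :: "'i filter \<Rightarrow> ('i \<Rightarrow> complex) set set \<Rightarrow> ('i \<Rightarrow> complex) set
    \<Rightarrow> ('i \<Rightarrow> complex) set set" where
  "hat U M c = M0 U M +>\<^bsub>(starC U)\<lparr>carrier := M\<rparr>\<^esub> c"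


section \<open>Smooth functions\<close>

definition pd :: "'n \<Rightarrow> (real^'n \<Rightarrow> complex) \<Rightarrow> real^'n \<Rightarrow> complex" where
  "pd j f x = vector_derivative (\<lambda>t. f (x + t *\<^sub>R axis j 1)) (at 0)"

text \<open>The partial derivatives are composed along a fixed enumeration of the index type; for
  smooth functions the order is irrelevant.\<close>

definition mpd :: "nat^'n \<Rightarrow> (real^'n \<Rightarrow> complex) \<Rightarrow> real^'n \<Rightarrow> complex" where
  "mpd \<alpha> = foldr (\<lambda>j g. (pd j ^^ (\<alpha> $ j)) \<circ> g) (map (from_nat_into UNIV) [0..<CARD('n)]) id"

primrec Ck_on :: "nat \<Rightarrow> (real^'n) set \<Rightarrow> (real^'n \<Rightarrow> complex) \<Rightarrow> bool" where
  "Ck_on 0 \<Omega> f \<longleftrightarrow> continuous_on \<Omega> f"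
| "Ck_on (Suc k) \<Omega> f \<longleftrightarrow> (\<forall>x\<in>\<Omega>. f differentiable at x) \<and> (\<forall>j. Ck_on k \<Omega> (pd j f))"

text \<open>Functions on \<open>\<Omega>\<close> are total functions taking the value \<open>undefined\<close> outside \<open>\<Omega>\<close>.\<close>

definition smooth_funs :: "(real^'n) set \<Rightarrow> (real^'n \<Rightarrow> complex) set" where
  "smooth_funs \<Omega> = {f \<in> extensional \<Omega>. \<forall>k. Ck_on k \<Omega> f}"

definition smooth_ring :: "(real^'n) set \<Rightarrow> (real^'n \<Rightarrow> complex) ring" where
  "smooth_ring \<Omega> =
    \<lparr>carrier = smooth_funs \<Omega>, mult = (\<lambda>f g. \<lambda>x\<in>\<Omega>. f x * g x), one = (\<lambda>x\<in>\<Omega>. 1),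
     zero = (\<lambda>x\<in>\<Omega>. 0), add = (\<lambda>f g. \<lambda>x\<in>\<Omega>. f x + g x)\<rparr>"

abbreviation starE :: "'i filter \<Rightarrow> (real^'n) set \<Rightarrow> ('i \<Rightarrow> real^'n \<Rightarrow> complex) set ring" where
  "starE U \<Omega> \<equiv> star_ring U (smooth_ring \<Omega>)"

definition star_app :: "'i filter \<Rightarrow> ('i \<Rightarrow> real^'n \<Rightarrow> complex) set \<Rightarrow> ('i \<Rightarrow> real^'n) set
    \<Rightarrow> ('i \<Rightarrow> complex) set" where
  "star_app U = star_map2 U (\<lambda>f x. f x)"

definition star_mpd :: "'i filter \<Rightarrow> (real^'n) set \<Rightarrow> nat^'n
    \<Rightarrow> ('i \<Rightarrow> real^'n \<Rightarrow> complex) set \<Rightarrow> ('i \<Rightarrow> real^'n \<Rightarrow> complex) set" where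
  "star_mpd U \<Omega> \<alpha> = star_map U (\<lambda>f. restrict (mpd \<alpha> f) \<Omega>)"

definition const_fun :: "'i filter \<Rightarrow> (real^'n) set \<Rightarrow> ('i \<Rightarrow> complex) set
    \<Rightarrow> ('i \<Rightarrow> real^'n \<Rightarrow> complex) set" where
  "const_fun U \<Omega> = star_map U (\<lambda>c. \<lambda>x\<in>\<Omega>. c)"

lemma star_app_const_fun:
  assumes "c \<in> carrier (starC U)" and "x \<in> star U \<Omega>"
  shows "star_app U (const_fun U \<Omega> c) x = c"
proof -
  obtain s where c: "c = star_class U s"
    using assms(1) by (auto simp: star_ring_def star_def)
  obtain r where x: "x = star_class U r" and "\<forall>i. r i \<in> \<Omega>"
    using assms(2) by (auto simp: star_def)
  then show ?thesis
    by (simp add: c const_fun_def star_app_def star_map_class star_map2_class)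
qed


section \<open>Generalized functions\<close>

definition infinitesimal :: "'i filter \<Rightarrow> ('i \<Rightarrow> real^'n) set \<Rightarrow> bool" where
  "infinitesimal U h \<longleftrightarrow> (\<forall>\<epsilon>>0. star_pred2 U (<) (star_map U norm h) (star_of U \<epsilon>))"

definition monad :: "'i filter \<Rightarrow> (real^'n) set \<Rightarrow> ('i \<Rightarrow> real^'n) set set" where
  "monad U \<Omega> = {star_map2 U (+) (star_of U r) h | r h.
      r \<in> \<Omega> \<and> h \<in> star U UNIV \<and> infinitesimal U h}"

text \<open>The definitions of \<open>\<M>(\<Omega>)\<close> and \<open>\<M>\<^sub>0(\<Omega>)\<close> only differ in the set of admitted values.\<close>

definition fun_ext :: "'i filter \<Rightarrow> ('i \<Rightarrow> complex) set set \<Rightarrow> (real^'n) set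
    \<Rightarrow> ('i \<Rightarrow> real^'n \<Rightarrow> complex) set set" where
  "fun_ext U A \<Omega> = {f \<in> carrier (starE U \<Omega>).
      \<forall>\<alpha>. \<forall>x \<in> monad U \<Omega>. star_app U (star_mpd U \<Omega> \<alpha> f) x \<in> A}"

abbreviation M_fun :: "'i filter \<Rightarrow> ('i \<Rightarrow> complex) set set \<Rightarrow> (real^'n) set
    \<Rightarrow> ('i \<Rightarrow> real^'n \<Rightarrow> complex) set set" where
  "M_fun U M \<Omega> \<equiv> fun_ext U M \<Omega>"

abbreviation M0_fun :: "'i filter \<Rightarrow> ('i \<Rightarrow> complex) set set \<Rightarrow> (real^'n) set
    \<Rightarrow> ('i \<Rightarrow> real^'n \<Rightarrow> complex) set set" where
  "M0_fun U M \<Omega> \<equiv> fun_ext U (M0 U M) \<Omega>"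

definition Mhat_fun :: "'i filter \<Rightarrow> ('i \<Rightarrow> complex) set set \<Rightarrow> (real^'n) set
    \<Rightarrow> ('i \<Rightarrow> real^'n \<Rightarrow> complex) set set ring" where
  "Mhat_fun U M \<Omega> = (starE U \<Omega>)\<lparr>carrier := M_fun U M \<Omega>\<rparr> Quot M0_fun U M \<Omega>"

definition hat_fun :: "'i filter \<Rightarrow> ('i \<Rightarrow> complex) set set \<Rightarrow> (real^'n) set
    \<Rightarrow> ('i \<Rightarrow> real^'n \<Rightarrow> complex) set \<Rightarrow> ('i \<Rightarrow> real^'n \<Rightarrow> complex) set set" where
  "hat_fun U M \<Omega> f = M0_fun U M \<Omega> +>\<^bsub>(starE U \<Omega>)\<lparr>carrier := M_fun U M \<Omega>\<rparr>\<^esub> f"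

text \<open>The derivative of a class is the class of the derivative of any of its elements, written as a
  union over the elements.\<close>

definition mpd_hat :: "'i filter \<Rightarrow> ('i \<Rightarrow> complex) set set \<Rightarrow> (real^'n) set \<Rightarrow> nat^'n
    \<Rightarrow> ('i \<Rightarrow> real^'n \<Rightarrow> complex) set set \<Rightarrow> ('i \<Rightarrow> real^'n \<Rightarrow> complex) set set" where
  "mpd_hat U M \<Omega> \<alpha> F = (\<Union>f\<in>F. hat_fun U M \<Omega> (star_mpd U \<Omega> \<alpha> f))"

definition grad_hat :: "'i filter \<Rightarrow> ('i \<Rightarrow> complex) set set \<Rightarrow> (real^'n) set
    \<Rightarrow> ('i \<Rightarrow> real^'n \<Rightarrow> complex) set set \<Rightarrow> ('i \<Rightarrow> real^'n \<Rightarrow> complex) set set ^ 'n" where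
  "grad_hat U M \<Omega> F = (\<chi> j. mpd_hat U M \<Omega> (axis j 1) F)"

end

theory Submission
  imports Defs
begin

text \<open>
  The kernel of the gradient is determined by the mean value inequality. Suppose that all first
  derivatives of \<open>f = \<langle>f\<^sub>i\<rangle>\<close> take values in \<open>\<M>\<^sub>0\<close> on the monad of \<open>\<Omega>\<close>. On a closed ball
  inside \<open>\<Omega>\<close> with a standard centre \<open>r\<close> the sum of the norms of the partial derivatives of
  \<open>f\<^sub>i\<close> is maximal at some point \<open>z\<^sub>i\<close>; by compactness \<open>\<langle>z\<^sub>i\<rangle>\<close> lies in the monad of \<open>\<Omega>\<close>, so
  \<open>f x - f r\<close> is dominated by an element of \<open>\<M>\<^sub>0\<close> for all \<open>x\<close> in the extended ball. Connectedness
  carries this over to any two points of the monad, hence \<open>f\<close> is congruent to the constant \<open>f a\<close>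
  for each \<open>a \<in> \<Omega>\<close>. That partial derivatives act on the quotient requires the symmetry of
  mixed derivatives.
\<close>

section \<open>Partial derivatives of smooth functions\<close>

lemma has_vector_derivative_along_line:
  fixes f :: "'a::real_normed_vector \<Rightarrow> 'b::real_normed_vector"
  assumes "(f has_derivative D) (at (x + t *\<^sub>R v))"
  shows "((\<lambda>s. f (x + s *\<^sub>R v)) has_vector_derivative D v) (at t)"
proof -
  interpret D: bounded_linear D
    using assms by (rule has_derivative_bounded_linear)
  have "((\<lambda>s. x + s *\<^sub>R v) has_derivative (\<lambda>s. s *\<^sub>R v)) (at t)"
    by (auto intro!: derivative_eq_intros)
  from diff_chain_at[OF this] assms
  have "(f \<circ> (\<lambda>s. x + s *\<^sub>R v) has_derivative D \<circ> (\<lambda>s. s *\<^sub>R v)) (at t)"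
    by blast
  then show ?thesis
    by (simp add: has_vector_derivative_def o_def D.scaleR)
qed

lemma pd_eq_derivative:
  assumes "(f has_derivative D) (at x)"
  shows "pd j f x = D (axis j 1)"
  unfolding pd_def
  by (rule vector_derivative_at, rule has_vector_derivative_along_line) (simp add: assms)

text \<open>Elements of \<open>smooth_funs \<Omega>\<close> are \<open>undefined\<close> outside
  \<open>\<Omega>\<close>, so every operation on them is a restriction. This lemma and its
  consequences remove such restrictions under derivatives, because a derivative at a point of an
  open set sees only a neighbourhood.\<close>

lemma pd_cong_on_open:
  assumes "open \<Omega>" "x \<in> \<Omega>" "f differentiable at x" "\<And>y. y \<in> \<Omega> \<Longrightarrow> f y = g y"
  shows "g differentiable at x" "pd j f x = pd j g x"
proof -
  obtain D where D: "(f has_derivative D) (at x)"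
    using assms(3) by (auto simp: differentiable_def)
  then have D': "(g has_derivative D) (at x)"
    by (rule has_derivative_transform_within_open[OF _ assms(1,2,4)])
  then show "g differentiable at x"
    by (auto simp: differentiable_def)
  show "pd j f x = pd j g x"
    using pd_eq_derivative[OF D] pd_eq_derivative[OF D'] by simp
qed

lemma pd_const [simp]: "pd j (\<lambda>_. c) = (\<lambda>_. 0)"
  using pd_eq_derivative[OF has_derivative_const] by fastforce

text \<open>The coefficient \<open>a\<close> lets one lemma serve sums (\<open>a = 1\<close>) and
  differences (\<open>a = -1\<close>).\<close>

lemma pd_lincomb:
  assumes "f differentiable at x" "g differentiable at x"
  shows "(\<lambda>y. f y + a * g y) differentiable at x"
    and "pd j (\<lambda>y. f y + a * g y) x = pd j f x + a * pd j g x"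
proof -
  obtain D E where D: "(f has_derivative D) (at x)" "(g has_derivative E) (at x)"
    using assms by (auto simp: differentiable_def)
  then have DE: "((\<lambda>y. f y + a * g y) has_derivative (\<lambda>v. D v + a * E v)) (at x)"
    by (intro has_derivative_add has_derivative_mult_right)
  then show "(\<lambda>y. f y + a * g y) differentiable at x"
    by (auto simp: differentiable_def)
  show "pd j (\<lambda>y. f y + a * g y) x = pd j f x + a * pd j g x"
    using pd_eq_derivative[OF D(1)] pd_eq_derivative[OF D(2)] pd_eq_derivative[OF DE] by simp
qed

section \<open>Closure properties of smooth functions\<close>

lemma Ck_on_cong:
  assumes "open \<Omega>" "Ck_on k \<Omega> f" "\<And>x. x \<in> \<Omega> \<Longrightarrow> f x = g x"
  shows "Ck_on k \<Omega> g"
  using assms(2,3)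
proof (induction k arbitrary: f g)
  case 0
  then show ?case
    by (auto cong: continuous_on_cong)
next
  case (Suc k)
  have "f differentiable at x" if "x \<in> \<Omega>" for x
    using Suc.prems(1) that by simp
  then have "g differentiable at x" "pd j f x = pd j g x" if "x \<in> \<Omega>" for x j
    using that Suc.prems(2)
    by (auto intro: pd_cong_on_open(1)[OF assms(1)] pd_cong_on_open(2)[OF assms(1)])
  moreover have "Ck_on k \<Omega> (pd j f)" for j
    using Suc.prems(1) by simp
  ultimately show ?case
    using Suc.IH[of "pd j f" "pd j g" for j] by auto
qed

lemma Ck_on_const: "Ck_on k \<Omega> (\<lambda>_. c)"
  by (induction k arbitrary: c) auto

lemma Ck_on_lincomb:
  assumes "open \<Omega>" "Ck_on k \<Omega> f" "Ck_on k \<Omega> g"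
  shows "Ck_on k \<Omega> (\<lambda>x. f x + a * g x)"
  using assms(2,3)
proof (induction k arbitrary: f g)
  case 0
  then show ?case
    by (auto intro!: continuous_intros)
next
  case (Suc k)
  have "Ck_on k \<Omega> (\<lambda>x. pd j f x + a * pd j g x)" for j
    using Suc by simp
  moreover have "pd j f x + a * pd j g x = pd j (\<lambda>y. f y + a * g y) x" if "x \<in> \<Omega>" for x j
    using Suc.prems that pd_lincomb(2)[of f x g j a] by simp
  ultimately have "Ck_on k \<Omega> (pd j (\<lambda>y. f y + a * g y))" for j
    by (rule Ck_on_cong[OF assms(1)])
  then show ?case
    using Suc.prems pd_lincomb(1) by auto
qed

text \<open>Smoothness without the extensionality of \<open>smooth_funs\<close>, so that it is
  stable under \<open>pd\<close>, whose values outside \<open>\<Omega>\<close> are not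
  controlled.\<close>

definition Cinf_on :: "(real^'n) set \<Rightarrow> (real^'n \<Rightarrow> complex) \<Rightarrow> bool" where
  "Cinf_on \<Omega> f \<longleftrightarrow> (\<forall>k. Ck_on k \<Omega> f)"

lemma smooth_funs_iff: "f \<in> smooth_funs \<Omega> \<longleftrightarrow> f \<in> extensional \<Omega> \<and> Cinf_on \<Omega> f"
  by (simp add: smooth_funs_def Cinf_on_def)

lemma Cinf_on_cong:
  "open \<Omega> \<Longrightarrow> Cinf_on \<Omega> f \<Longrightarrow> (\<And>x. x \<in> \<Omega> \<Longrightarrow> f x = g x) \<Longrightarrow> Cinf_on \<Omega> g"
  unfolding Cinf_on_def using Ck_on_cong by blast

lemma Cinf_on_const: "Cinf_on \<Omega> (\<lambda>_. c)"
  by (simp add: Cinf_on_def Ck_on_const)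

lemma Cinf_on_lincomb:
  "open \<Omega> \<Longrightarrow> Cinf_on \<Omega> f \<Longrightarrow> Cinf_on \<Omega> g \<Longrightarrow> Cinf_on \<Omega> (\<lambda>x. f x + a * g x)"
  unfolding Cinf_on_def using Ck_on_lincomb by blast

lemma restrict_smooth:
  assumes "open \<Omega>" "Cinf_on \<Omega> f"
  shows "restrict f \<Omega> \<in> smooth_funs \<Omega>"
  using Cinf_on_cong[OF assms, of "restrict f \<Omega>"] by (simp add: smooth_funs_iff)

lemma Cinf_on_pd: "Cinf_on \<Omega> f \<Longrightarrow> Cinf_on \<Omega> (pd j f)"
  unfolding Cinf_on_def by (metis Ck_on.simps(2))

lemma Cinf_on_differentiable: "Cinf_on \<Omega> f \<Longrightarrow> x \<in> \<Omega> \<Longrightarrow> f differentiable at x"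
  unfolding Cinf_on_def by (metis Ck_on.simps(2))

lemma Cinf_on_continuous: "Cinf_on \<Omega> f \<Longrightarrow> continuous_on \<Omega> f"
  unfolding Cinf_on_def by (metis Ck_on.simps(1))

section \<open>Mean value inequality and symmetry of mixed derivatives\<close>

lemma vector_derivative_bound:
  fixes f :: "real \<Rightarrow> 'a::real_normed_vector"
  assumes "0 \<le> h"
    and "\<And>t. 0 \<le> t \<Longrightarrow> t \<le> h \<Longrightarrow> (f has_vector_derivative f' t) (at t)"
    and "\<And>t. 0 \<le> t \<Longrightarrow> t \<le> h \<Longrightarrow> norm (f' t) \<le> B"
  shows "norm (f h - f 0) \<le> B * h"
proof -
  have "norm (f h - f 0) \<le> B * norm (h - 0)"
  proof (rule differentiable_bound[of "{0..h}" f "\<lambda>t s. s *\<^sub>R f' t"])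
    show "(f has_derivative (\<lambda>s. s *\<^sub>R f' t)) (at t within {0..h})" if "t \<in> {0..h}" for t
      using assms(2)[of t] that
      by (auto simp: has_vector_derivative_def intro: has_derivative_at_withinI)
    show "onorm (\<lambda>s. s *\<^sub>R f' t) \<le> B" if "t \<in> {0..h}" for t
      using assms(3)[of t] that
      by (intro onorm_le) (auto simp: mult.commute[of B] intro: mult_left_mono)
  qed (use assms(1) in auto)
  then show ?thesis
    using assms(1) by simp
qed

lemma Cinf_on_line:
  assumes "Cinf_on \<Omega> f" "x + t *\<^sub>R axis j 1 \<in> \<Omega>"
  shows "((\<lambda>s. f (x + s *\<^sub>R axis j 1)) has_vector_derivative pd j f (x + t *\<^sub>R axis j 1)) (at t)"
proof -
  obtain D where D: "(f has_derivative D) (at (x + t *\<^sub>R axis j 1))"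
    using Cinf_on_differentiable[OF assms] by (auto simp: differentiable_def)
  then show ?thesis
    using has_vector_derivative_along_line[OF D] pd_eq_derivative[OF D] by simp
qed

text \<open>The second difference with step \<open>h\<close>. It is symmetric in \<open>i\<close>
  and \<open>j\<close>, but is approximated by \<open>h\<^sup>2\<close> times the mixed derivative
  in either order.\<close>

definition mixed_difference ::
    "(real^'n \<Rightarrow> complex) \<Rightarrow> 'n \<Rightarrow> 'n \<Rightarrow> real^'n \<Rightarrow> real \<Rightarrow> complex" where
  "mixed_difference f i j x h = f (x + h *\<^sub>R axis i 1 + h *\<^sub>R axis j 1)
     - f (x + h *\<^sub>R axis i 1) - f (x + h *\<^sub>R axis j 1) + f x"

lemma mixed_difference_commute: "mixed_difference f i j x h = mixed_difference f j i x h"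
  by (simp add: mixed_difference_def algebra_simps)

text \<open>The mean value inequality is applied twice, in direction \<open>i\<close> and then in
  direction \<open>j\<close>, each time after subtracting the expected linear term. What remains is
  the oscillation of \<open>pd j (pd i f)\<close> near \<open>x\<close>, which continuity bounds by
  \<open>\<epsilon>\<close>.\<close>

lemma mixed_difference_approx:
  assumes "open \<Omega>" "Cinf_on \<Omega> f" "x \<in> \<Omega>" "\<epsilon> > 0"
  shows "\<forall>\<^sub>F h in at_right 0.
    norm (mixed_difference f i j x h - of_real (h\<^sup>2) * pd j (pd i f) x) \<le> \<epsilon> * h\<^sup>2"
proof -
  define L where "L = pd j (pd i f) x"
  have C: "Cinf_on \<Omega> (pd i f)" "Cinf_on \<Omega> (pd j (pd i f))"
    using assms(2) by (auto intro: Cinf_on_pd)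
  have "isCont (pd j (pd i f)) x"
    using Cinf_on_continuous[OF C(2)] assms(1,3) by (simp add: continuous_on_eq_continuous_at)
  then obtain d1 where d1: "d1 > 0" "\<And>y. dist y x < d1 \<Longrightarrow> dist (pd j (pd i f) y) L < \<epsilon>"
    unfolding continuous_at_eps_delta L_def using assms(4) by blast
  obtain d2 where d2: "d2 > 0" "ball x d2 \<subseteq> \<Omega>"
    using assms(1,3) openE by blast
  define d where "d = min d1 d2"
  have "d > 0"
    using d1 d2 by (simp add: d_def)
  have main: "norm (mixed_difference f i j x h - of_real (h\<^sup>2) * L) \<le> \<epsilon> * h\<^sup>2"
    if h: "0 < h" "h < d / 2" for h
  proof -
    \<comment> \<open>Two displacements of length at most \<open>h\<close> add up to norm at most
      \<open>2 * h\<close>, hence the restriction \<open>h < d / 2\<close>.\<close>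
    have close: "dist (x + s *\<^sub>R axis i 1 + t *\<^sub>R axis j 1) x < d"
      if "0 \<le> s" "s \<le> h" "0 \<le> t" "t \<le> h" for s t
    proof -
      have "norm (s *\<^sub>R axis i (1::real) + t *\<^sub>R axis j 1) \<le> \<bar>s\<bar> + \<bar>t\<bar>"
        by (rule order_trans[OF norm_triangle_ineq]) simp
      then show ?thesis
        using that h by (simp add: dist_norm add.assoc)
    qed
    have mem: "x + s *\<^sub>R axis i 1 + t *\<^sub>R axis j 1 \<in> \<Omega>"
      if "0 \<le> s" "s \<le> h" "0 \<le> t" "t \<le> h" for s t
      using close[OF that] d2(2) by (auto simp: d_def dist_commute)
    \<comment> \<open>The increment of \<open>\<phi>\<close> over \<open>[0, h]\<close> is the mixed
      difference minus \<open>h\<^sup>2 * L\<close>. Its derivative is an increment of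
      \<open>pd i f\<close> in direction \<open>j\<close> minus \<open>h * L\<close>, which is
      handled in the same way through \<open>\<psi>\<close>.\<close>
    define \<phi> where "\<phi> s = f (x + s *\<^sub>R axis i 1 + h *\<^sub>R axis j 1) - f (x + s *\<^sub>R axis i 1)
      - s *\<^sub>R (h *\<^sub>R L)" for s
    have "norm (\<phi> h - \<phi> 0) \<le> (\<epsilon> * h) * h"
    proof (rule vector_derivative_bound)
      fix s assume s: "0 \<le> s" "s \<le> h"
      have "((\<lambda>s. f ((x + h *\<^sub>R axis j 1) + s *\<^sub>R axis i 1)) has_vector_derivative
          pd i f ((x + h *\<^sub>R axis j 1) + s *\<^sub>R axis i 1)) (at s)"
        using mem[of s h] s h by (intro Cinf_on_line[OF assms(2)]) (simp add: ac_simps)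
      moreover have "((\<lambda>s. f (x + s *\<^sub>R axis i 1)) has_vector_derivative
          pd i f (x + s *\<^sub>R axis i 1)) (at s)"
        using mem[of s 0] s h by (intro Cinf_on_line[OF assms(2)]) simp
      ultimately show "(\<phi> has_vector_derivative
          pd i f (x + s *\<^sub>R axis i 1 + h *\<^sub>R axis j 1) - pd i f (x + s *\<^sub>R axis i 1) - h *\<^sub>R L) (at s)"
        unfolding \<phi>_def by (auto intro!: derivative_eq_intros simp: ac_simps)
      define \<psi> where "\<psi> t = pd i f (x + s *\<^sub>R axis i 1 + t *\<^sub>R axis j 1) - t *\<^sub>R L" for t
      have "norm (\<psi> h - \<psi> 0) \<le> \<epsilon> * h"
      proof (rule vector_derivative_bound)
        fix t assume t: "0 \<le> t" "t \<le> h"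
        have "((\<lambda>t. pd i f (x + s *\<^sub>R axis i 1 + t *\<^sub>R axis j 1)) has_vector_derivative
          pd j (pd i f) (x + s *\<^sub>R axis i 1 + t *\<^sub>R axis j 1)) (at t)"
          using mem[of s t] s t by (intro Cinf_on_line[OF C(1)]) simp
        then show "(\<psi> has_vector_derivative
            pd j (pd i f) (x + s *\<^sub>R axis i 1 + t *\<^sub>R axis j 1) - L) (at t)"
          unfolding \<psi>_def by (auto intro!: derivative_eq_intros)
        show "norm (pd j (pd i f) (x + s *\<^sub>R axis i 1 + t *\<^sub>R axis j 1) - L) \<le> \<epsilon>"
          using d1(2)[of "x + s *\<^sub>R axis i 1 + t *\<^sub>R axis j 1"] close[of s t] s t
          by (simp add: dist_norm d_def)
      qed (use h in simp)
      then show "norm (pd i f (x + s *\<^sub>R axis i 1 + h *\<^sub>R axis j 1) - pd i f (x + s *\<^sub>R axis i 1)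
          - h *\<^sub>R L) \<le> \<epsilon> * h"
        by (simp add: \<psi>_def algebra_simps)
    qed (use h in simp)
    moreover have "\<phi> h - \<phi> 0 = mixed_difference f i j x h - of_real (h\<^sup>2) * L"
      by (simp add: \<phi>_def mixed_difference_def scaleR_conv_of_real power2_eq_square algebra_simps)
    ultimately show ?thesis
      by (simp add: power2_eq_square mult.assoc)
  qed
  show ?thesis
    unfolding eventually_at_right_field L_def[symmetric]
    using main \<open>d > 0\<close> by (intro exI[of _ "d / 2"]) auto
qed

text \<open>Both mixed derivatives approximate the same second difference divided by
  \<open>h\<^sup>2\<close>, so they cannot differ.\<close>

lemma pd_commute:
  assumes "open \<Omega>" "Cinf_on \<Omega> f" "x \<in> \<Omega>"
  shows "pd i (pd j f) x = pd j (pd i f) x"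
proof (rule ccontr)
  define a b where "a = pd i (pd j f) x" and "b = pd j (pd i f) x"
  assume "pd i (pd j f) x \<noteq> pd j (pd i f) x"
  \<comment> \<open>With a quarter of the distance as \<open>\<epsilon>\<close> the two errors add
    up to half of \<open>norm (a - b) * h\<^sup>2\<close>, which is too little to account for the
    whole of it.\<close>
  then have pos: "norm (a - b) / 4 > 0"
    by (simp add: a_def b_def)
  have "\<forall>\<^sub>F h::real in at_right 0. False"
    using eventually_at_right_less mixed_difference_approx[OF assms pos, of i j]
      mixed_difference_approx[OF assms pos, of j i]
  proof eventually_elim
    case (elim h)
    have "norm (of_real (h\<^sup>2) * (a - b)) =
        norm ((mixed_difference f i j x h - of_real (h\<^sup>2) * b)
          - (mixed_difference f j i x h - of_real (h\<^sup>2) * a))"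
      by (simp add: mixed_difference_commute[of f j i] algebra_simps)
    also have "\<dots> \<le> norm (a - b) / 4 * h\<^sup>2 + norm (a - b) / 4 * h\<^sup>2"
      by (rule order_trans[OF norm_triangle_ineq4 add_mono])
        (use elim(2,3) in \<open>simp_all add: a_def b_def\<close>)
    finally have "norm (a - b) * h\<^sup>2 \<le> norm (a - b) * h\<^sup>2 / 2"
      by (simp add: norm_mult norm_power)
    moreover have "norm (a - b) * h\<^sup>2 > 0"
      using pos elim(1) by (intro mult_pos_pos) auto
    ultimately show False
      by linarith
  qed
  then show False
    by (simp add: eventually_False)
qed

section \<open>Iterated derivatives indexed by lists\<close>

text \<open>Lists of indices, with the outermost derivative at the head, permit induction one
  derivative at a time and turn composition into \<open>@\<close>. Multi-indices only reappear when
  the definition of \<open>fun_ext\<close> is unfolded.\<close>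

definition pds :: "'n list \<Rightarrow> (real^'n \<Rightarrow> complex) \<Rightarrow> real^'n \<Rightarrow> complex" where
  "pds js f = foldr pd js f"

lemma pds_simps [simp]: "pds [] f = f" "pds (j # js) f = pd j (pds js f)"
  by (simp_all add: pds_def)

lemma pds_append: "pds (js @ ks) f = pds js (pds ks f)"
  by (simp add: pds_def)

lemma Cinf_on_pds: "Cinf_on \<Omega> f \<Longrightarrow> Cinf_on \<Omega> (pds js f)"
  by (induction js) (auto intro: Cinf_on_pd)

lemma pds_cong:
  assumes "open \<Omega>" "Cinf_on \<Omega> f" "\<And>y. y \<in> \<Omega> \<Longrightarrow> f y = g y" "x \<in> \<Omega>"
  shows "pds js f x = pds js g x"
  using assms(4)
proof (induction js arbitrary: x)
  case (Cons j js)
  then show ?case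
    using pd_cong_on_open(2)[OF assms(1) Cons.prems
        Cinf_on_differentiable[OF Cinf_on_pds[OF assms(2)] Cons.prems] Cons.IH] by simp
qed (use assms(3) in simp)

lemma pds_const: "pds js (\<lambda>_. c) = (\<lambda>_. if js = [] then c else 0)"
  by (induction js) auto

lemma pds_lincomb:
  assumes "open \<Omega>" "Cinf_on \<Omega> f" "Cinf_on \<Omega> g" "x \<in> \<Omega>"
  shows "pds js (\<lambda>y. f y + a * g y) x = pds js f x + a * pds js g x"
  using assms(4)
proof (induction js arbitrary: x)
  case (Cons j js)
  have "pd j (pds js (\<lambda>y. f y + a * g y)) x = pd j (\<lambda>y. pds js f y + a * pds js g y) x"
    using Cinf_on_lincomb[OF assms(1-3)] Cons.prems Cons.IH
    by (intro pd_cong_on_open(2)[OF assms(1)]) (auto intro: Cinf_on_differentiable Cinf_on_pds)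
  also have "\<dots> = pd j (pds js f) x + a * pd j (pds js g) x"
    using assms(2,3) Cons.prems
    by (intro pd_lincomb(2)) (auto intro: Cinf_on_differentiable Cinf_on_pds)
  finally show ?case
    by simp
qed simp

text \<open>By induction, the first occurrence of \<open>j\<close> moves outwards past one entry at
  a time by \<open>pd_commute\<close>.\<close>

lemma pds_remove1:
  assumes "open \<Omega>" "Cinf_on \<Omega> f" "j \<in> set js" "x \<in> \<Omega>"
  shows "pds js f x = pd j (pds (remove1 j js) f) x"
  using assms(3,4)
proof (induction js arbitrary: x)
  case (Cons k ks)
  show ?case
  proof (cases "k = j")
    case False
    then have IH: "pds ks f y = pd j (pds (remove1 j ks) f) y" if "y \<in> \<Omega>" for y
      using Cons that by simp
    have "pd k (pds ks f) x = pd k (pd j (pds (remove1 j ks) f)) x"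
      using assms(2) Cons.prems(2) IH
      by (intro pd_cong_on_open(2)[OF assms(1)]) (auto intro: Cinf_on_differentiable Cinf_on_pds)
    also have "\<dots> = pd j (pd k (pds (remove1 j ks) f)) x"
      using Cinf_on_pds[OF assms(2)] Cons.prems(2) by (rule pd_commute[OF assms(1)])
    finally show ?thesis
      using False by simp
  qed simp
qed simp

text \<open>The head of \<open>js\<close> is pulled to the front of \<open>ks\<close>, and the
  remaining lists again have equal multisets.\<close>

lemma pds_mset_cong:
  assumes "open \<Omega>" "Cinf_on \<Omega> f" "mset js = mset ks" "x \<in> \<Omega>"
  shows "pds js f x = pds ks f x"
  using assms(3,4)
proof (induction js arbitrary: ks x)
  case (Cons j js)
  then have j: "j \<in> set ks" and "mset js = mset (remove1 j ks)"
    by (metis list.set_intros(1) set_mset_mset, metis mset_remove1 remove1.simps(2))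
  then have IH: "pds js f y = pds (remove1 j ks) f y" if "y \<in> \<Omega>" for y
    using Cons.IH that by blast
  have "pd j (pds js f) x = pd j (pds (remove1 j ks) f) x"
    using assms(2) Cons.prems(2) IH
    by (intro pd_cong_on_open(2)[OF assms(1)]) (auto intro: Cinf_on_differentiable Cinf_on_pds)
  then show ?case
    using pds_remove1[OF assms(1,2) j Cons.prems(2)] by simp
qed simp

text \<open>Follows the enumeration used in \<open>mpd\<close>, so that \<open>mpd_eq_pds\<close> is
  an equality of operators on all functions, smooth or not.\<close>

definition index_list :: "nat^'n \<Rightarrow> 'n list" where
  "index_list \<alpha> = concat (map (\<lambda>j. replicate (\<alpha> $ j) j) (map (from_nat_into UNIV) [0..<CARD('n)]))"

lemma mpd_eq_pds: "mpd \<alpha> f = pds (index_list \<alpha>) f"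
proof -
  have rep: "(pd j ^^ n) g = pds (replicate n j) g" for j and n and g :: "real^'n \<Rightarrow> complex"
    by (induction n) auto
  have "foldr (\<lambda>j g. (pd j ^^ (\<alpha> $ j)) \<circ> g) js id f =
      pds (concat (map (\<lambda>j. replicate (\<alpha> $ j) j) js)) f" for js
    by (induction js) (auto simp: rep pds_append)
  then show ?thesis
    by (simp add: mpd_def index_list_def)
qed

lemma count_index_list: "count (mset (index_list \<alpha>)) j = \<alpha> $ j"
proof -
  define js where "js = map (from_nat_into (UNIV :: 'a set)) [0..<CARD('a)]"
  \<comment> \<open>The enumeration is a bijection, so \<open>j\<close> belongs to exactly one block
    of the concatenation.\<close>
  have bij: "bij_betw (from_nat_into (UNIV :: 'a set)) {..<CARD('a)} UNIV"
    by (rule bij_betw_from_nat_into_finite) simp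
  then have "distinct js"
    by (auto simp: js_def distinct_map bij_betw_def atLeast0LessThan)
  moreover have "j \<in> set js"
    using bij by (auto simp: js_def bij_betw_def atLeast0LessThan)
  moreover have "count (mset (concat (map (\<lambda>j. replicate (\<alpha> $ j) j) ks))) j =
      (if j \<in> set ks then \<alpha> $ j else 0)" if "distinct ks" for ks
    using that by (induction ks) auto
  ultimately show ?thesis
    unfolding index_list_def js_def by (simp del: map_map)
qed

text \<open>Up to order, every list comes from the multi-index of its multiplicities. Here symmetry
  of the derivatives enters, and conditions on all multi-indices become conditions on all
  lists.\<close>

lemma mpd_eq_pds_count:
  assumes "open \<Omega>" "Cinf_on \<Omega> f" "x \<in> \<Omega>"
  shows "mpd (\<chi> j. count (mset js) j) f x = pds js f x"
  unfolding mpd_eq_pds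
  by (rule pds_mset_cong[OF assms(1,2) _ assms(3)]) (simp add: multiset_eq_iff count_index_list)

text \<open>A list whose multiset is a singleton is that singleton, so no reordering and no
  smoothness are involved.\<close>

lemma mpd_axis: "mpd (axis j 1) f = pd j f"
proof -
  have "mset (index_list (axis j 1 :: nat^'a)) = mset [j]"
    by (simp add: multiset_eq_iff count_index_list axis_def)
  then have "index_list (axis j 1 :: nat^'a) = [j]"
    by simp
  then show ?thesis
    by (simp add: mpd_eq_pds)
qed

text \<open>Along the segment the derivative of \<open>f\<close> is the combination of the partial
  derivatives with the coordinates of \<open>v\<close> as coefficients, each of modulus at most
  \<open>norm v\<close>. The sum of norms is the form of the bound that \<open>N_sum_norm\<close>
  can treat.\<close>

lemma Cinf_on_segment_bound:
  assumes "Cinf_on \<Omega> f" "closed_segment x y \<subseteq> \<Omega>"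
    and B: "\<And>z. z \<in> closed_segment x y \<Longrightarrow> (\<Sum>j\<in>UNIV. norm (pd j f z)) \<le> B"
  shows "norm (f y - f x) \<le> B * norm (y - x)"
proof -
  define v where "v = y - x"
  have seg: "x + t *\<^sub>R v \<in> closed_segment x y" if "0 \<le> t" "t \<le> 1" for t
    unfolding closed_segment_def v_def using that by (auto intro!: exI[of _ t] simp: algebra_simps)
  have D: "(f has_derivative frechet_derivative f (at z)) (at z)" if "z \<in> closed_segment x y" for z
    using Cinf_on_differentiable[OF assms(1)] assms(2) that frechet_derivative_works by blast
  have "norm ((\<lambda>t. f (x + t *\<^sub>R v)) 1 - (\<lambda>t. f (x + t *\<^sub>R v)) 0) \<le> (B * norm v) * 1"
  proof (rule vector_derivative_bound)
    fix t :: real assume t: "0 \<le> t" "t \<le> 1"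
    define z where "z = x + t *\<^sub>R v"
    have z: "z \<in> closed_segment x y"
      using seg[OF t] by (simp add: z_def)
    interpret F: bounded_linear "frechet_derivative f (at z)"
      using D[OF z] by (rule has_derivative_bounded_linear)
    show "((\<lambda>t. f (x + t *\<^sub>R v)) has_vector_derivative
        frechet_derivative f (at (x + t *\<^sub>R v)) v) (at t)"
      using D[OF z] unfolding z_def by (rule has_vector_derivative_along_line)
    have "frechet_derivative f (at z) v = frechet_derivative f (at z) (\<Sum>j\<in>UNIV. v $ j *\<^sub>R axis j 1)"
      by (subst basis_expansion[symmetric]) (simp add: scalar_mult_eq_scaleR)
    also have "\<dots> = (\<Sum>j\<in>UNIV. v $ j *\<^sub>R pd j f z)"
      by (simp add: F.sum F.scaleR pd_eq_derivative[OF D[OF z]])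
    also have "norm \<dots> \<le> (\<Sum>j\<in>UNIV. norm v * norm (pd j f z))"
      by (intro sum_norm_le) (simp add: mult_right_mono component_le_norm_cart)
    also have "\<dots> \<le> B * norm v"
      using mult_right_mono[OF B[OF z], of "norm v"] by (simp add: sum_distrib_left mult.commute)
    finally show "norm (frechet_derivative f (at (x + t *\<^sub>R v)) v) \<le> B * norm v"
      by (simp add: z_def)
  qed simp
  then show ?thesis
    by (simp add: v_def)
qed


section \<open>Convex subrings\<close>

lemma star_ring_simps [simp]:
  "carrier (star_ring U R) = star U (carrier R)"
  "\<zero>\<^bsub>star_ring U R\<^esub> = star_class U (\<lambda>_. \<zero>\<^bsub>R\<^esub>)"
  "\<one>\<^bsub>star_ring U R\<^esub> = star_class U (\<lambda>_. \<one>\<^bsub>R\<^esub>)"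
  "star_class U s \<oplus>\<^bsub>star_ring U R\<^esub> star_class U t = star_class U (\<lambda>i. s i \<oplus>\<^bsub>R\<^esub> t i)"
  "star_class U s \<otimes>\<^bsub>star_ring U R\<^esub> star_class U t = star_class U (\<lambda>i. s i \<otimes>\<^bsub>R\<^esub> t i)"
  by (simp_all add: star_ring_def star_of_def star_map2_class)

lemma star_classI: "(\<And>i. s i \<in> S) \<Longrightarrow> star_class U s \<in> star U S"
  by (auto simp: star_def)

lemma star_cases:
  assumes "z \<in> star U S"
  obtains s where "z = star_class U s" "\<And>i. s i \<in> S"
  using assms by (auto simp: star_def)

lemma complex_ring_simps [simp]:
  "carrier complex_ring = UNIV" "\<zero>\<^bsub>complex_ring\<^esub> = 0" "\<one>\<^bsub>complex_ring\<^esub> = 1"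
  "a \<oplus>\<^bsub>complex_ring\<^esub> b = a + b" "a \<otimes>\<^bsub>complex_ring\<^esub> b = a * b"
  by (simp_all add: complex_ring_def)

lemma abelian_group_star_ring:
  assumes "abelian_group R"
  shows "abelian_group (star_ring U R)"
proof -
  interpret R: abelian_group R
    by fact
  show ?thesis
  proof (rule abelian_groupI)
    fix x assume "x \<in> carrier (star_ring U R)"
    then obtain s where s: "x = star_class U s" "\<And>i. s i \<in> carrier R"
      by (auto elim: star_cases)
    then show "\<exists>y\<in>carrier (star_ring U R). y \<oplus>\<^bsub>star_ring U R\<^esub> x = \<zero>\<^bsub>star_ring U R\<^esub>"
      by (intro bexI[of _ "star_class U (\<lambda>i. \<ominus>\<^bsub>R\<^esub> s i)"])
        (auto simp: R.l_neg intro: star_classI)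
  qed (auto elim!: star_cases intro!: star_classI simp: R.a_ac)
qed

lemma abelian_group_complex_ring: "abelian_group complex_ring"
  by (rule abelian_groupI) (auto intro: exI[of _ "- x" for x])

text \<open>Negation in a ring record is only given by a description. Asking for some additive
  inverse inside \<open>H\<close> allows it to be exhibited on representatives.\<close>

lemma abelian_subgroup_closureI:
  assumes "abelian_group G" "H \<subseteq> carrier G" "\<zero>\<^bsub>G\<^esub> \<in> H"
    and "\<And>x y. x \<in> H \<Longrightarrow> y \<in> H \<Longrightarrow> x \<oplus>\<^bsub>G\<^esub> y \<in> H"
    and "\<And>x. x \<in> H \<Longrightarrow> \<exists>y\<in>H. y \<oplus>\<^bsub>G\<^esub> x = \<zero>\<^bsub>G\<^esub>"
  shows "abelian_subgroup H G"
proof -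
  interpret G: abelian_group G
    by fact
  have "subgroup H (add_monoid G)"
  proof (rule G.add.subgroupI)
    fix x assume x: "x \<in> H"
    then obtain y where "y \<in> H" "y \<oplus>\<^bsub>G\<^esub> x = \<zero>\<^bsub>G\<^esub>"
      using assms(5) by blast
    then show "\<ominus>\<^bsub>G\<^esub> x \<in> H"
      using x assms(2) G.minus_equality[of y x] by auto
  qed (use assms in auto)
  then show ?thesis
    by (intro abelian_subgroupI3 additive_subgroupI assms(1))
qed

lemma (in abelian_subgroup) a_coset_eq_iff:
  assumes "x \<in> carrier G" "y \<in> carrier G"
  shows "H +> x = H +> y \<longleftrightarrow> (\<exists>h\<in>H. x = h \<oplus> y)"
proof
  assume "H +> x = H +> y"
  then have "x \<in> H +> y"
    using a_rcos_self[OF assms(1)] by simp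
  then show "\<exists>h\<in>H. x = h \<oplus> y"
    by (auto simp: a_r_coset_def')
next
  assume "\<exists>h\<in>H. x = h \<oplus> y"
  then have "x \<in> H +> y"
    by (auto simp: a_r_coset_def')
  then show "H +> x = H +> y"
    using a_repr_independence'[OF _ assms(2)] by simp
qed

text \<open>Additive cosets depend on the addition alone, so the quotients of \<open>M\<close> and
  of \<open>M_fun U M \<Omega>\<close> can be studied with cosets in the ambient ultrapower.\<close>

lemma a_r_coset_carrier_update: "H +>\<^bsub>R\<lparr>carrier := A\<rparr>\<^esub> x = H +>\<^bsub>R\<^esub> x"
  by (simp add: a_r_coset_def r_coset_def)

lemma carrier_FactRing_update: "carrier (R\<lparr>carrier := A\<rparr> Quot H) = (\<lambda>x. H +>\<^bsub>R\<^esub> x) ` A"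
  by (auto simp: FactRing_def A_RCOSETS_def' a_r_coset_carrier_update)

section \<open>A convex subring and its maximal ideal\<close>

locale convex_ultrapower_subring =
  fixes U :: "'i filter" and M :: "('i \<Rightarrow> complex) set set"
  assumes ultra: "ultrafilter U" and convex: "convex_subring U M"
begin

text \<open>Read as: \<open>s\<close> is negligible. The ideal is handled from here on through
  representatives and estimates that hold eventually along \<open>U\<close>.\<close>

abbreviation N :: "('i \<Rightarrow> complex) \<Rightarrow> bool" where
  "N s \<equiv> star_class U s \<in> M0 U M"

lemma ultra_cases:
  obtains "eventually P U" | "\<forall>\<^sub>F i in U. \<not> P i"
  using ultra unfolding ultrafilter_def by blast

lemma M_subring: "subring M (starC U)"
  using convex by (simp add: convex_subring_def)

lemma M_star: "z \<in> M \<Longrightarrow> \<exists>s. z = star_class U s"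
  using subringE(1)[OF M_subring] by (auto elim: star_cases)

lemma M_one: "star_class U (\<lambda>_. 1) \<in> M"
  using subringE(3)[OF M_subring] by simp

lemma M_add: "star_class U s \<in> M \<Longrightarrow> star_class U t \<in> M \<Longrightarrow> star_class U (\<lambda>i. s i + t i) \<in> M"
  using subringE(7)[OF M_subring, of "star_class U s" "star_class U t"] by simp

lemma M_dom:
  assumes "star_class U t \<in> M" "\<forall>\<^sub>F i in U. norm (s i) \<le> norm (t i)"
  shows "star_class U s \<in> M"
proof -
  have "star_class U s \<in> carrier (starC U)"
    by (simp add: star_classI)
  moreover have "star_pred2 U (\<le>) (star_map U norm (star_class U s)) (star_map U norm (star_class U t))"
    using assms(2) by (simp add: star_map_class star_pred2_class)
  ultimately show ?thesis
    using convex assms(1) unfolding convex_subring_def by blast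
qed

lemma M_zero: "star_class U (\<lambda>_. 0) \<in> M"
  by (rule M_dom[OF M_one]) simp

text \<open>A family that is not eventually zero is eventually nonzero along an ultrafilter, so the
  pointwise inverse works. \<open>m_inv\<close> is a definite description, whence the uniqueness
  part.\<close>

lemma starC_inverse:
  assumes "\<not> (\<forall>\<^sub>F i in U. s i = 0)"
  shows "inv\<^bsub>starC U\<^esub> star_class U s = star_class U (\<lambda>i. inverse (s i))"
proof -
  have nz: "\<forall>\<^sub>F i in U. s i \<noteq> 0"
    using assms ultra_cases[of "\<lambda>i. s i = 0"] by blast
  show ?thesis
    unfolding m_inv_def
  proof (rule the_equality)
    show "star_class U (\<lambda>i. inverse (s i)) \<in> carrier (starC U) \<and>
        star_class U s \<otimes>\<^bsub>starC U\<^esub> star_class U (\<lambda>i. inverse (s i)) = \<one>\<^bsub>starC U\<^esub> \<and>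
        star_class U (\<lambda>i. inverse (s i)) \<otimes>\<^bsub>starC U\<^esub> star_class U s = \<one>\<^bsub>starC U\<^esub>"
      using nz by (auto simp: star_class_eq_iff intro!: star_classI elim: eventually_mono)
  next
    fix y assume y: "y \<in> carrier (starC U) \<and> star_class U s \<otimes>\<^bsub>starC U\<^esub> y = \<one>\<^bsub>starC U\<^esub> \<and>
        y \<otimes>\<^bsub>starC U\<^esub> star_class U s = \<one>\<^bsub>starC U\<^esub>"
    then obtain t where t: "y = star_class U t"
      by (auto elim: star_cases)
    then have "\<forall>\<^sub>F i in U. s i * t i = 1"
      using y by (simp add: star_class_eq_iff)
    then have "\<forall>\<^sub>F i in U. t i = inverse (s i)"
      by eventually_elim (simp add: inverse_unique)
    then show "y = star_class U (\<lambda>i. inverse (s i))"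
      by (simp add: t star_class_eq_iff)
  qed
qed

text \<open>Membership in \<open>M\<close> need not be checked separately: if \<open>1/s\<close> is
  not in \<open>M\<close>, then \<open>s\<close> has modulus at most 1, since otherwise
  \<open>1/s\<close> would have modulus at most 1 and lie in \<open>M\<close> by convexity.\<close>

lemma N_iff: "N s \<longleftrightarrow> (\<forall>\<^sub>F i in U. s i = 0) \<or> star_class U (\<lambda>i. inverse (s i)) \<notin> M"
proof (cases "\<forall>\<^sub>F i in U. s i = 0")
  case True
  then have "star_class U s = star_class U (\<lambda>_. 0)"
    by (simp add: star_class_eq_iff)
  then show ?thesis
    using True M_zero by (simp add: M0_def)
next
  case False
  have "star_class U s \<in> M" if inv: "star_class U (\<lambda>i. inverse (s i)) \<notin> M"
  proof (cases rule: ultra_cases[of "\<lambda>i. norm (s i) \<le> 1"])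
    case 1
    then show ?thesis
      by (intro M_dom[OF M_one]) simp
  next
    case 2
    then have "\<forall>\<^sub>F i in U. norm (inverse (s i)) \<le> norm (1::complex)"
      by eventually_elim (auto simp: norm_inverse intro: inverse_le_1_iff[THEN iffD2])
    then have "star_class U (\<lambda>i. inverse (s i)) \<in> M"
      by (rule M_dom[OF M_one])
    then show ?thesis
      using inv by contradiction
  qed
  then show ?thesis
    using False by (auto simp: M0_def starC_inverse star_class_eq_iff)
qed

lemma N_zero: "N (\<lambda>_. 0)"
  by (simp add: N_iff)

text \<open>Convexity passes to the ideal by inversion: a bound of \<open>s\<close> by
  \<open>t\<close> is a bound of \<open>1/t\<close> by \<open>1/s\<close>, so \<open>1/t\<close>
  would lie in \<open>M\<close> together with \<open>1/s\<close>.\<close>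

lemma N_dom:
  assumes "N t" "\<forall>\<^sub>F i in U. norm (s i) \<le> norm (t i)"
  shows "N s"
proof (rule ccontr)
  assume "\<not> N s"
  then have s: "\<not> (\<forall>\<^sub>F i in U. s i = 0)" "star_class U (\<lambda>i. inverse (s i)) \<in> M"
    by (auto simp: N_iff)
  then have nz: "\<forall>\<^sub>F i in U. s i \<noteq> 0"
    using ultra_cases[of "\<lambda>i. s i = 0"] by blast
  with assms(2) have "\<forall>\<^sub>F i in U. norm (inverse (t i)) \<le> norm (inverse (s i))"
    by eventually_elim (simp add: norm_inverse le_imp_inverse_le)
  then have "star_class U (\<lambda>i. inverse (t i)) \<in> M"
    by (rule M_dom[OF s(2)])
  then have "\<forall>\<^sub>F i in U. t i = 0"
    using assms(1) by (simp add: N_iff)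
  with assms(2) have "\<forall>\<^sub>F i in U. s i = 0"
    by eventually_elim simp
  with s(1) show False ..
qed

lemma N_cong: "\<forall>\<^sub>F i in U. norm (s i) = norm (t i) \<Longrightarrow> N s \<longleftrightarrow> N t"
  by (metis (mono_tags, lifting) N_dom eventually_mono order_refl)

lemma N_double:
  assumes "N s"
  shows "N (\<lambda>i. 2 * s i)"
proof (rule ccontr)
  assume "\<not> N (\<lambda>i. 2 * s i)"
  then have *: "\<not> (\<forall>\<^sub>F i in U. s i = 0)" "star_class U (\<lambda>i. inverse (2 * s i)) \<in> M"
    by (auto simp: N_iff)
  \<comment> \<open>This also holds where \<open>s i = 0\<close>, because
    \<open>inverse 0 = 0\<close>.\<close>
  have "(\<lambda>i. inverse (2 * s i) + inverse (2 * s i)) = (\<lambda>i. inverse (s i))"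
    by (simp add: field_simps)
  then have "star_class U (\<lambda>i. inverse (s i)) \<in> M"
    using M_add[OF *(2) *(2)] by simp
  then show False
    using assms *(1) by (simp add: N_iff)
qed

text \<open>The ultrafilter decides which of the two moduli is eventually the larger one, and the
  sum is dominated by twice that term.\<close>

lemma N_add:
  assumes "N s" "N t"
  shows "N (\<lambda>i. s i + t i)"
proof (cases rule: ultra_cases[of "\<lambda>i. norm (s i) \<le> norm (t i)"])
  case 1
  then have "\<forall>\<^sub>F i in U. norm (s i + t i) \<le> norm (2 * t i)"
    by eventually_elim (rule order_trans[OF norm_triangle_ineq], simp add: norm_mult)
  then show ?thesis
    by (rule N_dom[OF N_double[OF assms(2)]])
next
  case 2
  then have "\<forall>\<^sub>F i in U. norm (s i + t i) \<le> norm (2 * s i)"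
    by eventually_elim (rule order_trans[OF norm_triangle_ineq], simp add: norm_mult)
  then show ?thesis
    by (rule N_dom[OF N_double[OF assms(1)]])
qed

lemma N_uminus: "N s \<Longrightarrow> N (\<lambda>i. - s i)"
  by (erule N_dom) simp

text \<open>Meant for the sum of the norms of the first derivatives. The embedding into the complex
  numbers is there because \<open>N\<close> speaks of complex families.\<close>

lemma N_sum_norm:
  assumes "finite J" "\<And>j. j \<in> J \<Longrightarrow> N (\<lambda>i. g j i)"
  shows "N (\<lambda>i. \<Sum>j\<in>J. of_real (norm (g j i)))"
  using assms
proof (induction J)
  case empty
  then show ?case
    by (simp add: N_zero)
next
  case (insert k J)
  have "N (\<lambda>i. of_real (norm (g k i)))"
    by (rule N_dom[of "\<lambda>i. g k i"]) (auto simp: insert.prems)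
  then show ?case
    using insert N_add by simp
qed

lemma abelian_subgroup_M0: "abelian_subgroup (M0 U M) (starC U)"
proof (rule abelian_subgroup_closureI)
  show "abelian_group (starC U)"
    by (intro abelian_group_star_ring abelian_group_complex_ring)
  have M0E: "\<exists>s. x = star_class U s \<and> N s" if "x \<in> M0 U M" for x
    using that M_star[of x] by (auto simp: M0_def)
  show "M0 U M \<subseteq> carrier (starC U)"
    using M0E by (auto intro: star_classI)
  show "\<zero>\<^bsub>starC U\<^esub> \<in> M0 U M"
    by (simp add: N_zero)
  show "x \<oplus>\<^bsub>starC U\<^esub> y \<in> M0 U M" if xy: "x \<in> M0 U M" "y \<in> M0 U M" for x y
    using M0E[OF xy(1)] M0E[OF xy(2)] by (auto simp: N_add)
  show "\<exists>y\<in>M0 U M. y \<oplus>\<^bsub>starC U\<^esub> x = \<zero>\<^bsub>starC U\<^esub>" if x: "x \<in> M0 U M" for x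
  proof -
    obtain s where "x = star_class U s" "N s"
      using M0E[OF x] by blast
    then show ?thesis
      by (intro bexI[of _ "star_class U (\<lambda>i. - s i)"]) (auto simp: N_uminus)
  qed
qed

lemma hat_eq_iff: "hat U M (star_class U s) = hat U M (star_class U t) \<longleftrightarrow> N (\<lambda>i. s i - t i)"
proof -
  interpret abelian_subgroup "M0 U M" "starC U"
    by (rule abelian_subgroup_M0)
  have "hat U M (star_class U s) = hat U M (star_class U t) \<longleftrightarrow>
      (\<exists>h\<in>M0 U M. star_class U s = h \<oplus>\<^bsub>starC U\<^esub> star_class U t)"
    unfolding hat_def a_r_coset_carrier_update
    by (rule a_coset_eq_iff) (simp_all add: star_classI)
  also have "\<dots> \<longleftrightarrow> N (\<lambda>i. s i - t i)"
  proof
    assume "\<exists>h\<in>M0 U M. star_class U s = h \<oplus>\<^bsub>starC U\<^esub> star_class U t"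
    then obtain h where h: "h \<in> M0 U M" "star_class U s = h \<oplus>\<^bsub>starC U\<^esub> star_class U t"
      by blast
    obtain u where u: "h = star_class U u"
      using h(1) M_star[of h] by (auto simp: M0_def)
    have "\<forall>\<^sub>F i in U. s i = u i + t i"
      using h(2) by (simp add: u star_class_eq_iff)
    then have "\<forall>\<^sub>F i in U. norm (s i - t i) = norm (u i)"
      by eventually_elim simp
    then show "N (\<lambda>i. s i - t i)"
      using h(1) N_cong by (simp add: u)
  qed (auto intro!: bexI[of _ "star_class U (\<lambda>i. s i - t i)"])
  finally show ?thesis .
qed

end


section \<open>Generalized functions\<close>

lemma smooth_ring_simps [simp]:
  "carrier (smooth_ring \<Omega>) = smooth_funs \<Omega>" "\<zero>\<^bsub>smooth_ring \<Omega>\<^esub> = (\<lambda>x\<in>\<Omega>. 0)"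
  "f \<oplus>\<^bsub>smooth_ring \<Omega>\<^esub> g = (\<lambda>x\<in>\<Omega>. f x + g x)"
  by (simp_all add: smooth_ring_def)

lemma smooth_funs_lincomb:
  assumes "open \<Omega>" "f \<in> smooth_funs \<Omega>" "g \<in> smooth_funs \<Omega>"
  shows "(\<lambda>x\<in>\<Omega>. f x + a * g x) \<in> smooth_funs \<Omega>"
  using assms by (intro restrict_smooth Cinf_on_lincomb) (auto simp: smooth_funs_iff)

lemma abelian_group_smooth_ring:
  assumes "open \<Omega>"
  shows "abelian_group (smooth_ring \<Omega>)"
proof (rule abelian_groupI)
  show "f \<oplus>\<^bsub>smooth_ring \<Omega>\<^esub> g \<in> carrier (smooth_ring \<Omega>)"
    if "f \<in> carrier (smooth_ring \<Omega>)" "g \<in> carrier (smooth_ring \<Omega>)" for f g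
    using smooth_funs_lincomb[OF assms, of f g 1] that by simp
  show zero: "\<zero>\<^bsub>smooth_ring \<Omega>\<^esub> \<in> carrier (smooth_ring \<Omega>)"
    using assms by (simp add: restrict_smooth Cinf_on_const)
  show "\<exists>g\<in>carrier (smooth_ring \<Omega>). g \<oplus>\<^bsub>smooth_ring \<Omega>\<^esub> f = \<zero>\<^bsub>smooth_ring \<Omega>\<^esub>"
    if f: "f \<in> carrier (smooth_ring \<Omega>)" for f
  proof
    show "(\<lambda>x\<in>\<Omega>. (\<lambda>x\<in>\<Omega>. 0) x + (-1) * f x) \<in> carrier (smooth_ring \<Omega>)"
      using smooth_funs_lincomb[OF assms, of "\<lambda>x\<in>\<Omega>. 0" f "-1"] f zero by simp
  qed (auto simp: fun_eq_iff)
qed (auto simp: smooth_funs_iff fun_eq_iff extensional_def algebra_simps)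

section \<open>Nearstandard families and the monad\<close>

text \<open>Describes points of the monad by their representatives. Individual \<open>x i\<close>
  may lie outside \<open>\<Omega>\<close>; for open \<open>\<Omega>\<close> they lie inside
  eventually along \<open>U\<close>.\<close>

definition nearstandard :: "'i filter \<Rightarrow> 'a::topological_space set \<Rightarrow> ('i \<Rightarrow> 'a) \<Rightarrow> bool" where
  "nearstandard U \<Omega> x \<longleftrightarrow> (\<exists>r\<in>\<Omega>. (x \<longlongrightarrow> r) U)"

lemma nearstandard_const: "r \<in> \<Omega> \<Longrightarrow> nearstandard U \<Omega> (\<lambda>_. r)"
  by (auto simp: nearstandard_def)

lemma nearstandard_eventually:
  "open \<Omega> \<Longrightarrow> nearstandard U \<Omega> x \<Longrightarrow> \<forall>\<^sub>F i in U. x i \<in> \<Omega>"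
  by (auto simp: nearstandard_def intro: topological_tendstoD)

text \<open>A family represents an infinitesimal exactly if it tends to 0 along
  \<open>U\<close>.\<close>

lemma monad_eq:
  fixes \<Omega> :: "(real^'n) set"
  shows "monad U \<Omega> = star_class U ` {x. nearstandard U \<Omega> x}"
proof -
  have inf: "infinitesimal U (star_class U h) \<longleftrightarrow> (h \<longlongrightarrow> 0) U" for h :: "'a \<Rightarrow> real^'n"
    by (simp add: infinitesimal_def star_of_def star_map_class star_pred2_class tendsto_iff)
  show ?thesis
  proof (intro equalityI subsetI)
    fix X assume "X \<in> monad U \<Omega>"
    then obtain r h where r: "r \<in> \<Omega>" and h: "(h \<longlongrightarrow> 0) U"
        and X: "X = star_map2 U (+) (star_of U r) (star_class U h)"
      unfolding monad_def by (auto simp: inf elim!: star_cases)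
    have "((\<lambda>i. r + h i) \<longlongrightarrow> r) U"
      using tendsto_add[OF tendsto_const h, of r] by simp
    then show "X \<in> star_class U ` {x. nearstandard U \<Omega> x}"
      using r by (auto simp: X star_of_def star_map2_class nearstandard_def)
  next
    fix X assume "X \<in> star_class U ` {x. nearstandard U \<Omega> x}"
    then obtain x r where X: "X = star_class U x" and r: "r \<in> \<Omega>" "(x \<longlongrightarrow> r) U"
      by (auto simp: nearstandard_def)
    have "((\<lambda>i. x i - r) \<longlongrightarrow> 0) U"
      using tendsto_diff[OF r(2) tendsto_const, of r] by simp
    then show "X \<in> monad U \<Omega>"
      unfolding monad_def using r(1)
      by (auto simp: X inf star_of_def star_map2_class star_classI
          intro!: exI[of _ r] exI[of _ "star_class U (\<lambda>i. x i - r)"])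
  qed
qed

text \<open>Compactness gives a cluster point of the image filter, and an ultrafilter converges to
  each of its cluster points.\<close>

lemma ultrafilter_compact_limit:
  assumes "ultrafilter U" "compact K" "\<forall>\<^sub>F i in U. z i \<in> K"
  obtains s where "s \<in> K" "(z \<longlongrightarrow> s) U"
proof -
  have "filtermap z U \<noteq> bot"
    using assms(1) by (simp add: ultrafilter_def filtermap_bot_iff)
  moreover have "\<forall>\<^sub>F x in filtermap z U. x \<in> K"
    using assms(3) by (simp add: eventually_filtermap)
  ultimately obtain s where s: "s \<in> K" "inf (nhds s) (filtermap z U) \<noteq> bot"
    using assms(2) unfolding compact_filter by blast
  have "(z \<longlongrightarrow> s) U"
  proof (rule topological_tendstoI, rule ccontr)
    fix S assume S: "open S" "s \<in> S" "\<not> (\<forall>\<^sub>F i in U. z i \<in> S)"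
    have "\<forall>\<^sub>F i in U. z i \<notin> S"
      using assms(1) S(3) unfolding ultrafilter_def by blast
    moreover have "\<forall>\<^sub>F x in nhds s. x \<in> S"
      using S(1,2) by (rule eventually_nhds_in_open)
    ultimately have "\<forall>\<^sub>F x in inf (nhds s) (filtermap z U). False"
      unfolding eventually_inf eventually_filtermap by (intro exI[of _ "\<lambda>x. x \<in> S"]
          exI[of _ "\<lambda>x. x \<notin> S"]) auto
    then show False
      using s(2) by (simp add: eventually_False)
  qed
  with s(1) show ?thesis
    by (rule that)
qed

lemma star_mpd_axis:
  "star_mpd U \<Omega> (axis j 1) (star_class U f) = star_class U (\<lambda>i. restrict (pd j (f i)) \<Omega>)"
  by (simp add: star_mpd_def star_map_class mpd_axis del: One_nat_def)

text \<open>Translates membership into lists and representatives. Keeping \<open>A\<close> arbitrary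
  covers both \<open>M_fun\<close> and \<open>M0_fun\<close>.\<close>

lemma fun_ext_iff:
  assumes "open \<Omega>" "\<And>i. f i \<in> smooth_funs \<Omega>"
  shows "star_class U f \<in> fun_ext U A \<Omega> \<longleftrightarrow>
    (\<forall>js x. nearstandard U \<Omega> x \<longrightarrow> star_class U (\<lambda>i. pds js (f i) (x i)) \<in> A)"
proof -
  have app: "star_app U (star_mpd U \<Omega> \<alpha> (star_class U f)) (star_class U x) =
      star_class U (\<lambda>i. pds (index_list \<alpha>) (f i) (x i))" if "nearstandard U \<Omega> x" for \<alpha> x
  proof -
    have "\<forall>\<^sub>F i in U. restrict (mpd \<alpha> (f i)) \<Omega> (x i) = pds (index_list \<alpha>) (f i) (x i)"
      using nearstandard_eventually[OF assms(1) that] by eventually_elim (simp add: mpd_eq_pds)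
    then show ?thesis
      by (simp add: star_app_def star_mpd_def star_map_class star_map2_class star_class_eq_iff)
  qed
  have all: "star_class U (\<lambda>i. pds (index_list (\<chi> j. count (mset js) j)) (f i) (x i)) =
      star_class U (\<lambda>i. pds js (f i) (x i))" if "nearstandard U \<Omega> x" for js x
  proof -
    have "\<forall>\<^sub>F i in U. pds (index_list (\<chi> j. count (mset js) j)) (f i) (x i) = pds js (f i) (x i)"
      using nearstandard_eventually[OF assms(1) that]
    proof eventually_elim
      case (elim i)
      then show ?case
        using mpd_eq_pds_count[OF assms(1) _ elim, of "f i" js] assms(2)[of i]
        by (simp add: mpd_eq_pds smooth_funs_iff)
    qed
    then show ?thesis
      by (simp add: star_class_eq_iff)
  qed
  have carr: "star_class U f \<in> carrier (starE U \<Omega>)"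
    using assms(2) by (simp add: star_classI)
  show ?thesis
  proof
    assume L: "star_class U f \<in> fun_ext U A \<Omega>"
    show "\<forall>js x. nearstandard U \<Omega> x \<longrightarrow> star_class U (\<lambda>i. pds js (f i) (x i)) \<in> A"
    proof (intro allI impI)
      fix js x assume x: "nearstandard U \<Omega> x"
      have "star_app U (star_mpd U \<Omega> (\<chi> j. count (mset js) j) (star_class U f)) (star_class U x) \<in> A"
        using L x unfolding fun_ext_def monad_eq by blast
      then show "star_class U (\<lambda>i. pds js (f i) (x i)) \<in> A"
        by (simp add: app[OF x] all[OF x])
    qed
  qed (use carr app in \<open>auto simp: fun_ext_def monad_eq\<close>)
qed

section \<open>Generalized functions modulo negligible ones\<close>

locale generalized_functions = convex_ultrapower_subring U M
  for U :: "'i filter" and M :: "('i \<Rightarrow> complex) set set" +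
  fixes \<Omega> :: "(real^'n) set"
  assumes open_\<Omega>: "open \<Omega>"
begin

lemma fun_extD:
  "F \<in> fun_ext U A \<Omega> \<Longrightarrow> \<exists>f. F = star_class U f \<and> (\<forall>i. f i \<in> smooth_funs \<Omega>)"
  by (auto simp: fun_ext_def star_def)

lemma pds_restrict_lincomb:
  assumes "f \<in> smooth_funs \<Omega>" "g \<in> smooth_funs \<Omega>" "x \<in> \<Omega>"
  shows "pds js (\<lambda>x\<in>\<Omega>. f x + a * g x) x = pds js f x + a * pds js g x"
proof -
  have C: "Cinf_on \<Omega> f" "Cinf_on \<Omega> g"
    using assms by (auto simp: smooth_funs_iff)
  have "pds js (\<lambda>x\<in>\<Omega>. f x + a * g x) x = pds js (\<lambda>x. f x + a * g x) x"
    by (rule pds_cong[OF open_\<Omega> Cinf_on_lincomb[OF open_\<Omega> C], symmetric]) (simp_all add: assms(3))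
  then show ?thesis
    by (simp add: pds_lincomb[OF open_\<Omega> C assms(3)])
qed

lemma pds_restrict_const:
  assumes "x \<in> \<Omega>"
  shows "pds js (\<lambda>x\<in>\<Omega>. c) x = (if js = [] then c else 0)"
  using pds_cong[OF open_\<Omega> Cinf_on_const, of c "\<lambda>x\<in>\<Omega>. c" x js] assms by (simp add: pds_const)

lemma smooth_const: "(\<lambda>x\<in>\<Omega>. c) \<in> smooth_funs \<Omega>"
  by (rule restrict_smooth[OF open_\<Omega> Cinf_on_const])

lemma smooth_pd: "f \<in> smooth_funs \<Omega> \<Longrightarrow> restrict (pd j f) \<Omega> \<in> smooth_funs \<Omega>"
  by (intro restrict_smooth open_\<Omega> Cinf_on_pd) (simp add: smooth_funs_iff)

text \<open>A coefficient of modulus 1 suffices for the group structure: \<open>a = 1\<close> gives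
  sums and \<open>a = -1\<close> gives negatives.\<close>

lemma M0_fun_lincomb:
  assumes f: "\<And>i. f i \<in> smooth_funs \<Omega>" "star_class U f \<in> M0_fun U M \<Omega>"
    and g: "\<And>i. g i \<in> smooth_funs \<Omega>" "star_class U g \<in> M0_fun U M \<Omega>"
    and a: "norm a = 1"
  shows "star_class U (\<lambda>i. \<lambda>x\<in>\<Omega>. f i x + a * g i x) \<in> M0_fun U M \<Omega>"
proof (subst fun_ext_iff[OF open_\<Omega> smooth_funs_lincomb[OF open_\<Omega> f(1) g(1)]], intro allI impI)
  fix js x assume x: "nearstandard U \<Omega> x"
  have "N (\<lambda>i. pds js (f i) (x i))" "N (\<lambda>i. pds js (g i) (x i))"
    using f g x by (simp_all add: fun_ext_iff[OF open_\<Omega>])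
  moreover from this(2) have "N (\<lambda>i. a * pds js (g i) (x i))"
    by (rule N_dom) (simp add: a norm_mult)
  ultimately have sum: "N (\<lambda>i. pds js (f i) (x i) + a * pds js (g i) (x i))"
    by (intro N_add)
  have "\<forall>\<^sub>F i in U. norm (pds js (\<lambda>x\<in>\<Omega>. f i x + a * g i x) (x i))
      = norm (pds js (f i) (x i) + a * pds js (g i) (x i))"
    using nearstandard_eventually[OF open_\<Omega> x]
    by eventually_elim (simp add: pds_restrict_lincomb f g)
  from N_cong[OF this] show "N (\<lambda>i. pds js (\<lambda>x\<in>\<Omega>. f i x + a * g i x) (x i))"
    using sum by simp
qed

lemma M0_fun_zero: "star_class U (\<lambda>_. \<lambda>x\<in>\<Omega>. 0) \<in> M0_fun U M \<Omega>"
proof (subst fun_ext_iff[OF open_\<Omega> smooth_const], intro allI impI)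
  fix js x assume "nearstandard U \<Omega> x"
  from nearstandard_eventually[OF open_\<Omega> this]
  have "\<forall>\<^sub>F i in U. pds js (\<lambda>x\<in>\<Omega>. 0) (x i) = 0"
    by eventually_elim (simp add: pds_restrict_const)
  then show "N (\<lambda>i. pds js (\<lambda>x\<in>\<Omega>. 0) (x i))"
    by (simp add: N_iff)
qed

lemma abelian_subgroup_M0_fun: "abelian_subgroup (M0_fun U M \<Omega>) (starE U \<Omega>)"
proof (rule abelian_subgroup_closureI)
  show "abelian_group (starE U \<Omega>)"
    by (intro abelian_group_star_ring abelian_group_smooth_ring open_\<Omega>)
  show "M0_fun U M \<Omega> \<subseteq> carrier (starE U \<Omega>)"
    by (auto simp: fun_ext_def)
  show "\<zero>\<^bsub>starE U \<Omega>\<^esub> \<in> M0_fun U M \<Omega>"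
    using M0_fun_zero by simp
  show "F \<oplus>\<^bsub>starE U \<Omega>\<^esub> G \<in> M0_fun U M \<Omega>"
    if FG: "F \<in> M0_fun U M \<Omega>" "G \<in> M0_fun U M \<Omega>" for F G
  proof -
    obtain f where f: "F = star_class U f" "\<And>i. f i \<in> smooth_funs \<Omega>"
      using fun_extD[OF FG(1)] by blast
    obtain g where g: "G = star_class U g" "\<And>i. g i \<in> smooth_funs \<Omega>"
      using fun_extD[OF FG(2)] by blast
    show ?thesis
      using M0_fun_lincomb[where f = f and g = g and a = 1] f g FG by simp
  qed
  show "\<exists>G\<in>M0_fun U M \<Omega>. G \<oplus>\<^bsub>starE U \<Omega>\<^esub> F = \<zero>\<^bsub>starE U \<Omega>\<^esub>"
    if F: "F \<in> M0_fun U M \<Omega>" for F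
  proof -
    obtain f where f: "F = star_class U f" "\<And>i. f i \<in> smooth_funs \<Omega>"
      using fun_extD[OF F] by blast
    have "star_class U (\<lambda>i. \<lambda>x\<in>\<Omega>. (\<lambda>x\<in>\<Omega>. 0) x + (-1) * f i x) \<in> M0_fun U M \<Omega>"
      using F f by (intro M0_fun_lincomb M0_fun_zero smooth_const) auto
    moreover have "star_class U (\<lambda>i. \<lambda>x\<in>\<Omega>. (\<lambda>x\<in>\<Omega>. 0) x + (-1) * f i x) \<oplus>\<^bsub>starE U \<Omega>\<^esub> F
        = \<zero>\<^bsub>starE U \<Omega>\<^esub>"
      by (auto simp: f star_class_eq_iff intro!: always_eventually)
    ultimately show ?thesis
      by blast
  qed
qed

lemma hat_fun_eq_iff:
  assumes f: "\<And>i. f i \<in> smooth_funs \<Omega>" and g: "\<And>i. g i \<in> smooth_funs \<Omega>"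
  shows "hat_fun U M \<Omega> (star_class U f) = hat_fun U M \<Omega> (star_class U g) \<longleftrightarrow>
    (\<forall>js x. nearstandard U \<Omega> x \<longrightarrow> N (\<lambda>i. pds js (f i) (x i) - pds js (g i) (x i)))"
    (is "_ \<longleftrightarrow> ?R")
proof -
  interpret abelian_subgroup "M0_fun U M \<Omega>" "starE U \<Omega>"
    by (rule abelian_subgroup_M0_fun)
  have "hat_fun U M \<Omega> (star_class U f) = hat_fun U M \<Omega> (star_class U g) \<longleftrightarrow>
      (\<exists>h\<in>M0_fun U M \<Omega>. star_class U f = h \<oplus>\<^bsub>starE U \<Omega>\<^esub> star_class U g)"
    unfolding hat_fun_def a_r_coset_carrier_update
    by (rule a_coset_eq_iff) (simp_all add: star_classI f g)
  also have "\<dots> \<longleftrightarrow> ?R"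
  proof
    assume "\<exists>h\<in>M0_fun U M \<Omega>. star_class U f = h \<oplus>\<^bsub>starE U \<Omega>\<^esub> star_class U g"
    then obtain H where H: "H \<in> M0_fun U M \<Omega>" "star_class U f = H \<oplus>\<^bsub>starE U \<Omega>\<^esub> star_class U g"
      by blast
    obtain h where h: "H = star_class U h" "\<And>i. h i \<in> smooth_funs \<Omega>"
      using fun_extD[OF H(1)] by blast
    have eq: "\<forall>\<^sub>F i in U. f i = (\<lambda>x\<in>\<Omega>. h i x + 1 * g i x)"
      using H(2) by (simp add: h star_class_eq_iff)
    show ?R
    proof (intro allI impI)
      fix js x assume x: "nearstandard U \<Omega> x"
      from eq nearstandard_eventually[OF open_\<Omega> x]
      have "\<forall>\<^sub>F i in U. norm (pds js (f i) (x i) - pds js (g i) (x i)) = norm (pds js (h i) (x i))"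
      proof eventually_elim
        case (elim i)
        then show ?case
          using pds_restrict_lincomb[OF h(2)[of i] g[of i] elim(2), of js 1] by simp
      qed
      from N_cong[OF this] show "N (\<lambda>i. pds js (f i) (x i) - pds js (g i) (x i))"
        using H(1) h x by (simp add: fun_ext_iff[OF open_\<Omega>])
    qed
  next
    assume R: ?R
    let ?h = "\<lambda>i. \<lambda>x\<in>\<Omega>. f i x + (-1) * g i x"
    have "star_class U ?h \<in> M0_fun U M \<Omega>"
    proof (subst fun_ext_iff[OF open_\<Omega> smooth_funs_lincomb[OF open_\<Omega> f g]], intro allI impI)
      fix js x assume x: "nearstandard U \<Omega> x"
      from nearstandard_eventually[OF open_\<Omega> x]
      have "\<forall>\<^sub>F i in U. norm (pds js (?h i) (x i)) = norm (pds js (f i) (x i) - pds js (g i) (x i))"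
      proof eventually_elim
        case (elim i)
        then show ?case
          by (subst pds_restrict_lincomb[OF f g]) simp_all
      qed
      from N_cong[OF this] show "N (\<lambda>i. pds js (?h i) (x i))"
        using R x by simp
    qed
    \<comment> \<open>The equality holds outside \<open>\<Omega>\<close> too, where both sides are
      \<open>undefined\<close>.\<close>
    moreover have "f i = (\<lambda>x\<in>\<Omega>. ?h i x + g i x)" for i
      using f[of i] by (auto simp: smooth_funs_iff extensional_def)
    then have "star_class U f = star_class U ?h \<oplus>\<^bsub>starE U \<Omega>\<^esub> star_class U g"
      by (auto simp: star_class_eq_iff intro!: always_eventually)
    ultimately show "\<exists>h\<in>M0_fun U M \<Omega>. star_class U f = h \<oplus>\<^bsub>starE U \<Omega>\<^esub> star_class U g"
      by blast
  qed
  finally show ?thesis .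
qed

section \<open>The gradient on the quotient\<close>

text \<open>The innermost derivative stands last in the list, hence \<open>js @ [j]\<close>.\<close>

lemma fun_ext_pd_iff:
  assumes f: "\<And>i. f i \<in> smooth_funs \<Omega>"
  shows "star_class U (\<lambda>i. restrict (pd j (f i)) \<Omega>) \<in> fun_ext U A \<Omega> \<longleftrightarrow>
    (\<forall>js x. nearstandard U \<Omega> x \<longrightarrow> star_class U (\<lambda>i. pds (js @ [j]) (f i) (x i)) \<in> A)"
proof -
  have "star_class U (\<lambda>i. pds js (restrict (pd j (f i)) \<Omega>) (x i)) =
      star_class U (\<lambda>i. pds (js @ [j]) (f i) (x i))" if x: "nearstandard U \<Omega> x" for js x
  proof -
    from nearstandard_eventually[OF open_\<Omega> x]
    have "\<forall>\<^sub>F i in U. pds js (restrict (pd j (f i)) \<Omega>) (x i) = pds (js @ [j]) (f i) (x i)"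
    proof eventually_elim
      case (elim i)
      have "pds js (pd j (f i)) (x i) = pds js (restrict (pd j (f i)) \<Omega>) (x i)"
        using f[of i] elim by (intro pds_cong[OF open_\<Omega>]) (auto simp: smooth_funs_iff Cinf_on_pd)
      then show ?case
        by (simp add: pds_append)
    qed
    then show ?thesis
      by (simp add: star_class_eq_iff)
  qed
  then show ?thesis
    by (simp add: fun_ext_iff[OF open_\<Omega> smooth_pd[OF f]])
qed

lemma M0_fun_pd:
  assumes "\<And>i. f i \<in> smooth_funs \<Omega>" "star_class U f \<in> M0_fun U M \<Omega>"
  shows "star_class U (\<lambda>i. restrict (pd j (f i)) \<Omega>) \<in> M0_fun U M \<Omega>"
  using assms by (simp add: fun_ext_pd_iff fun_ext_iff[OF open_\<Omega>])

text \<open>A zero gradient controls all derivatives of order at least one, since a class vanishes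
  only if all derivatives of its representatives are negligible. The value of \<open>f\<close>
  itself is left free.\<close>

lemma grad_hat_zero_iff:
  assumes f: "\<And>i. f i \<in> smooth_funs \<Omega>"
  shows "grad_hat U M \<Omega> (hat_fun U M \<Omega> (star_class U f)) = (\<chi> j. \<zero>\<^bsub>Mhat_fun U M \<Omega>\<^esub>) \<longleftrightarrow>
    (\<forall>js x. js \<noteq> [] \<longrightarrow> nearstandard U \<Omega> x \<longrightarrow> N (\<lambda>i. pds js (f i) (x i)))"
proof -
  interpret abelian_subgroup "M0_fun U M \<Omega>" "starE U \<Omega>"
    by (rule abelian_subgroup_M0_fun)
  let ?F = "hat_fun U M \<Omega> (star_class U f)"
  let ?d = "\<lambda>g j. star_class U (\<lambda>i. restrict (pd j (g i)) \<Omega>)"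
  have self: "star_class U g \<in> hat_fun U M \<Omega> (star_class U g)"
    if "\<And>i. g i \<in> smooth_funs \<Omega>" for g
    unfolding hat_fun_def a_r_coset_carrier_update
    using that by (intro a_rcos_self) (simp add: star_classI)
  have f_in_F: "star_class U f \<in> ?F"
    by (rule self) (rule f)
  have zero: "hat_fun U M \<Omega> G = M0_fun U M \<Omega>" if "G \<in> M0_fun U M \<Omega>" for G
    unfolding hat_fun_def a_r_coset_carrier_update using that by (rule a_rcos_const)
  have "mpd_hat U M \<Omega> (axis j 1) ?F = M0_fun U M \<Omega> \<longleftrightarrow> ?d f j \<in> M0_fun U M \<Omega>" for j
  proof
    assume L: "mpd_hat U M \<Omega> (axis j 1) ?F = M0_fun U M \<Omega>"
    have "?d f j \<in> hat_fun U M \<Omega> (star_mpd U \<Omega> (axis j 1) (star_class U f))"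
      unfolding star_mpd_axis by (rule self) (rule smooth_pd[OF f])
    then have "?d f j \<in> mpd_hat U M \<Omega> (axis j 1) ?F"
      unfolding mpd_hat_def by (rule UN_I[OF f_in_F])
    then show "?d f j \<in> M0_fun U M \<Omega>"
      by (simp only: L)
  next
    assume d: "?d f j \<in> M0_fun U M \<Omega>"
    \<comment> \<open>Independence of the representative: \<open>G\<close> differs from
      \<open>f\<close> by an element of \<open>M0_fun U M \<Omega>\<close>, and this set is closed
      under derivatives. All sets in the union defining \<open>mpd_hat\<close> therefore
      coincide.\<close>
    have "hat_fun U M \<Omega> (star_mpd U \<Omega> (axis j 1) G) = M0_fun U M \<Omega>" if G: "G \<in> ?F" for G
    proof -
      obtain H where H: "H \<in> M0_fun U M \<Omega>" "G = H \<oplus>\<^bsub>starE U \<Omega>\<^esub> star_class U f"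
        using G unfolding hat_fun_def a_r_coset_carrier_update a_r_coset_def' by auto
      obtain h where h: "H = star_class U h" "\<And>i. h i \<in> smooth_funs \<Omega>"
        using fun_extD[OF H(1)] by blast
      have dh: "?d h j \<in> M0_fun U M \<Omega>"
        using h(2) H(1) unfolding h(1) by (rule M0_fun_pd)
      have "star_mpd U \<Omega> (axis j 1) G = star_class U (\<lambda>i. restrict (pd j (\<lambda>x\<in>\<Omega>. h i x + f i x)) \<Omega>)"
        by (simp add: H(2) h star_mpd_axis del: One_nat_def)
      also have "\<dots> = star_class U (\<lambda>i. \<lambda>x\<in>\<Omega>. restrict (pd j (h i)) \<Omega> x + 1 * restrict (pd j (f i)) \<Omega> x)"
        using pds_restrict_lincomb[OF h(2) f, where js = "[j]" and a = 1]
        by (auto simp: star_class_eq_iff intro!: always_eventually restrict_ext)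
      also have "\<dots> \<in> M0_fun U M \<Omega>"
        by (intro M0_fun_lincomb smooth_pd h(2) f d dh) simp
      finally show ?thesis
        by (rule zero)
    qed
    then show "mpd_hat U M \<Omega> (axis j 1) ?F = M0_fun U M \<Omega>"
      unfolding mpd_hat_def using f_in_F by auto
  qed
  \<comment> \<open>The zero of the quotient ring is the ideal \<open>M0_fun U M \<Omega>\<close>
    itself.\<close>
  then have "grad_hat U M \<Omega> ?F = (\<chi> j. \<zero>\<^bsub>Mhat_fun U M \<Omega>\<^esub>) \<longleftrightarrow> (\<forall>j. ?d f j \<in> M0_fun U M \<Omega>)"
    by (simp add: grad_hat_def vec_eq_iff Mhat_fun_def FactRing_def)
  also have "\<dots> \<longleftrightarrow> (\<forall>js x. js \<noteq> [] \<longrightarrow> nearstandard U \<Omega> x \<longrightarrow> N (\<lambda>i. pds js (f i) (x i)))"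
    unfolding fun_ext_pd_iff[OF f]
  proof (intro iffI allI impI)
    fix js :: "'n list" and x
    assume "\<forall>j (js :: 'n list) x. nearstandard U \<Omega> x \<longrightarrow> N (\<lambda>i. pds (js @ [j]) (f i) (x i))"
      and "js \<noteq> []" "nearstandard U \<Omega> x"
    \<comment> \<open>A nonempty list is split at its last entry, the derivative taken
      first.\<close>
    then show "N (\<lambda>i. pds js (f i) (x i))"
      by (cases js rule: rev_cases) auto
  qed auto
  finally show ?thesis .
qed

section \<open>Constant functions\<close>

lemma const_fun_class: "const_fun U \<Omega> (star_class U s) = star_class U (\<lambda>i. \<lambda>x\<in>\<Omega>. s i)"
  by (simp add: const_fun_def star_map_class)

lemma pds_const_nearstandard:
  assumes "nearstandard U \<Omega> x"
  shows "star_class U (\<lambda>i. pds js (\<lambda>x\<in>\<Omega>. s i) (x i)) = (if js = [] then star_class U s else star_class U (\<lambda>_. 0))"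
  using nearstandard_eventually[OF open_\<Omega> assms]
  by (auto simp: star_class_eq_iff pds_restrict_const elim: eventually_mono)

lemma const_fun_in_M_fun:
  assumes "star_class U s \<in> M"
  shows "const_fun U \<Omega> (star_class U s) \<in> M_fun U M \<Omega>"
  unfolding const_fun_class using assms M_zero
  by (auto simp: fun_ext_iff[OF open_\<Omega> smooth_const] pds_const_nearstandard)

text \<open>Only the empty list contributes, as proper derivatives of constants vanish. A point of
  \<open>\<Omega>\<close> is needed to detect the difference, since the monad of the empty set is
  empty.\<close>

lemma hat_const_fun_eq_iff:
  assumes "\<Omega> \<noteq> {}"
  shows "hat_fun U M \<Omega> (const_fun U \<Omega> (star_class U s)) =
      hat_fun U M \<Omega> (const_fun U \<Omega> (star_class U t)) \<longleftrightarrow> N (\<lambda>i. s i - t i)"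
proof -
  obtain r where r: "r \<in> \<Omega>"
    using assms by blast
  have "hat_fun U M \<Omega> (const_fun U \<Omega> (star_class U s)) =
      hat_fun U M \<Omega> (const_fun U \<Omega> (star_class U t)) \<longleftrightarrow>
      (\<forall>js x. nearstandard U \<Omega> x \<longrightarrow> N (\<lambda>i. pds js (\<lambda>x\<in>\<Omega>. s i) (x i) - pds js (\<lambda>x\<in>\<Omega>. t i) (x i)))"
    unfolding const_fun_class by (rule hat_fun_eq_iff) (rule smooth_const)+
  also have "\<dots> \<longleftrightarrow> (\<forall>(js :: 'n list) x. nearstandard U \<Omega> x \<longrightarrow> js = [] \<longrightarrow> N (\<lambda>i. s i - t i))"
  proof -
    have "N (\<lambda>i. pds js (\<lambda>x\<in>\<Omega>. s i) (x i) - pds js (\<lambda>x\<in>\<Omega>. t i) (x i)) \<longleftrightarrow>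
        (js = [] \<longrightarrow> N (\<lambda>i. s i - t i))" if x: "nearstandard U \<Omega> x" for js x
    proof -
      have "star_class U (\<lambda>i. pds js (\<lambda>x\<in>\<Omega>. s i) (x i) - pds js (\<lambda>x\<in>\<Omega>. t i) (x i)) =
          (if js = [] then star_class U (\<lambda>i. s i - t i) else star_class U (\<lambda>_. 0))"
        using nearstandard_eventually[OF open_\<Omega> x]
        by (auto simp: star_class_eq_iff pds_restrict_const elim: eventually_mono)
      then show ?thesis
        by (simp add: N_zero)
    qed
    then show ?thesis
      by blast
  qed
  also have "\<dots> \<longleftrightarrow> N (\<lambda>i. s i - t i)"
    using nearstandard_const[OF r] by blast
  finally show ?thesis .
qed

section \<open>Functions with negligible gradient\<close>

text \<open>The mean value inequality needs one bound along a whole segment, so negligibility at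
  each single point must be made uniform. The maximum over the ball achieves this, being attained at
  a nearstandard family.\<close>

lemma small_oscillation_on_ball:
  assumes f: "\<And>i. f i \<in> smooth_funs \<Omega>"
    and grad: "\<And>j x. nearstandard U \<Omega> x \<Longrightarrow> N (\<lambda>i. pd j (f i) (x i))"
    and r: "r \<in> \<Omega>"
  shows "\<exists>e>0. cball r e \<subseteq> \<Omega> \<and>
    (\<forall>y. (\<forall>\<^sub>F i in U. y i \<in> cball r e) \<longrightarrow> N (\<lambda>i. f i (y i) - f i r))"
proof -
  obtain e0 where e0: "e0 > 0" "cball r e0 \<subseteq> \<Omega>"
    using open_\<Omega> r open_contains_cball by blast
  \<comment> \<open>A radius of at most 1 makes the factor \<open>norm (y i - r)\<close> disappear
    from the bound.\<close>
  define e where "e = min e0 1"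
  have e: "e > 0" "e \<le> 1" "cball r e \<subseteq> \<Omega>"
    using e0 by (auto simp: e_def)
  define G where "G i z = (\<Sum>j\<in>UNIV. norm (pd j (f i) z))" for i z
  have smooth: "Cinf_on \<Omega> (f i)" for i
    using f[of i] by (simp add: smooth_funs_iff)
  have "continuous_on (cball r e) (G i)" for i
    unfolding G_def
    by (intro continuous_intros continuous_on_subset[OF Cinf_on_continuous[OF Cinf_on_pd[OF smooth]] e(3)])
  then have "\<exists>z\<in>cball r e. \<forall>y\<in>cball r e. G i y \<le> G i z" for i
    using e(1) by (intro continuous_attains_sup) auto
  then obtain z where z: "\<And>i. z i \<in> cball r e" "\<And>i y. y \<in> cball r e \<Longrightarrow> G i y \<le> G i (z i)"
    by metis
  \<comment> \<open>The maximum points are chosen separately for each \<open>i\<close>; their limit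
    along \<open>U\<close> lies in the closed ball, hence in \<open>\<Omega>\<close>, so the
    hypothesis on the gradient applies to \<open>z\<close>.\<close>
  obtain s where "s \<in> cball r e" "(z \<longlongrightarrow> s) U"
    using ultrafilter_compact_limit[OF ultra compact_cball, of z r e] z(1) by auto
  then have "nearstandard U \<Omega> z"
    using e(3) by (auto simp: nearstandard_def)
  then have NG: "N (\<lambda>i. of_real (G i (z i)))"
    unfolding G_def of_real_sum by (intro N_sum_norm grad) auto
  have "N (\<lambda>i. f i (y i) - f i r)" if y: "\<forall>\<^sub>F i in U. y i \<in> cball r e" for y
  proof (rule N_dom[OF NG])
    show "\<forall>\<^sub>F i in U. norm (f i (y i) - f i r) \<le> norm (of_real (G i (z i)) :: complex)"
      using y
    proof eventually_elim
      case (elim i)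
      have seg: "closed_segment r (y i) \<subseteq> cball r e"
        using elim e(1) by (intro closed_segment_subset) auto
      have G0: "0 \<le> G i (z i)"
        by (simp add: G_def sum_nonneg)
      have "norm (f i (y i) - f i r) \<le> G i (z i) * norm (y i - r)"
        using seg e(3) z(2) by (intro Cinf_on_segment_bound[OF smooth]) (auto simp: G_def[symmetric])
      also have "\<dots> \<le> G i (z i) * 1"
        using elim e(2) G0 by (intro mult_left_mono) (auto simp: dist_norm norm_minus_commute)
      finally show ?case
        using G0 by simp
    qed
  qed
  with e show ?thesis
    by blast
qed

lemma small_oscillation:
  assumes f: "\<And>i. f i \<in> smooth_funs \<Omega>"
    and grad: "\<And>j x. nearstandard U \<Omega> x \<Longrightarrow> N (\<lambda>i. pd j (f i) (x i))"
    and conn: "connected \<Omega>" and a: "a \<in> \<Omega>" and x: "nearstandard U \<Omega> x"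
  shows "N (\<lambda>i. f i (x i) - f i a)"
proof -
  \<comment> \<open>For standard points, having negligibly different values is a symmetric and
    transitive relation that relates each point to a whole ball around it; on a connected set it
    relates all points.\<close>
  have standard: "N (\<lambda>i. f i b - f i a)" if b: "b \<in> \<Omega>" for b
  proof (rule connected_equivalence_relation[OF conn a b, where R = "\<lambda>u v. N (\<lambda>i. f i v - f i u)"])
    show "N (\<lambda>i. f i u - f i v)" if "N (\<lambda>i. f i v - f i u)" for u v
      using N_uminus[OF that] by simp
    show "N (\<lambda>i. f i w - f i u)" if "N (\<lambda>i. f i v - f i u)" "N (\<lambda>i. f i w - f i v)" for u v w
      using N_add[OF that] by simp
    show "\<exists>T. openin (top_of_set \<Omega>) T \<and> u \<in> T \<and> (\<forall>v\<in>T. N (\<lambda>i. f i v - f i u))"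
      if u: "u \<in> \<Omega>" for u
    proof -
      obtain e where e: "e > 0" "cball u e \<subseteq> \<Omega>"
          "\<And>y. \<forall>\<^sub>F i in U. y i \<in> cball u e \<Longrightarrow> N (\<lambda>i. f i (y i) - f i u)"
        using small_oscillation_on_ball[OF f grad u] by metis
      have "openin (top_of_set \<Omega>) (ball u e)"
        using e(2) ball_subset_cball by (force simp: openin_open_eq[OF open_\<Omega>])
      then show ?thesis
        \<comment> \<open>Standard points of the ball enter as constant families.\<close>
        using e(1) by (intro exI[of _ "ball u e"]) (auto intro!: e(3)[of "\<lambda>_. _"])
    qed
  qed
  obtain b where b: "b \<in> \<Omega>" "(x \<longlongrightarrow> b) U"
    using x by (auto simp: nearstandard_def)
  obtain e where e: "e > 0" "\<And>y. \<forall>\<^sub>F i in U. y i \<in> cball b e \<Longrightarrow> N (\<lambda>i. f i (y i) - f i b)"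
    using small_oscillation_on_ball[OF f grad b(1)] by metis
  \<comment> \<open>The family \<open>x\<close> is eventually in the ball around its limit
    \<open>b\<close>, so \<open>f x\<close> is compared with \<open>f b\<close> and then
    \<open>f b\<close> with \<open>f a\<close>.\<close>
  have "\<forall>\<^sub>F i in U. x i \<in> cball b e"
    using tendstoD[OF b(2) e(1)] by eventually_elim (simp add: dist_commute)
  from N_add[OF e(2)[OF this] standard[OF b(1)]] show ?thesis
    by simp
qed

section \<open>Identification of the constants\<close>

lemma Mhat_eq_zero_gradient:
  assumes "connected \<Omega>" "\<Omega> \<noteq> {}"
  shows "\<exists>\<iota>. (\<forall>c\<in>M. const_fun U \<Omega> c \<in> M_fun U M \<Omega> \<and>
                    \<iota> (hat U M c) = hat_fun U M \<Omega> (const_fun U \<Omega> c)) \<and>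
            inj_on \<iota> (carrier (Mhat U M)) \<and>
            \<iota> ` carrier (Mhat U M) =
              {F \<in> carrier (Mhat_fun U M \<Omega>).
                grad_hat U M \<Omega> F = (\<chi> j. \<zero>\<^bsub>Mhat_fun U M \<Omega>\<^esub>)}"
proof -
  let ?k = "\<lambda>c. hat_fun U M \<Omega> (const_fun U \<Omega> c)"
  have Mhat: "carrier (Mhat U M) = hat U M ` M"
    unfolding Mhat_def carrier_FactRing_update by (simp add: hat_def a_r_coset_carrier_update)
  have Mhat_fun: "carrier (Mhat_fun U M \<Omega>) = hat_fun U M \<Omega> ` M_fun U M \<Omega>"
    unfolding Mhat_fun_def carrier_FactRing_update by (simp add: hat_fun_def a_r_coset_carrier_update)
  have in_M_fun: "const_fun U \<Omega> c \<in> M_fun U M \<Omega>" if "c \<in> M" for c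
    using M_star[OF that] that const_fun_in_M_fun by blast
  \<comment> \<open>From right to left this is well-definedness of the map on classes, from left to
    right its injectivity.\<close>
  have eq_iff: "?k c = ?k d \<longleftrightarrow> hat U M c = hat U M d" if cd: "c \<in> M" "d \<in> M" for c d
  proof -
    obtain s where s: "c = star_class U s"
      using M_star[OF cd(1)] by blast
    obtain t where t: "d = star_class U t"
      using M_star[OF cd(2)] by blast
    show ?thesis
      by (simp add: s t hat_const_fun_eq_iff[OF assms(2)] hat_eq_iff)
  qed
  \<comment> \<open>The map is defined by choosing a representative; by \<open>eq_iff\<close> the
    result does not depend on the choice.\<close>
  define \<iota> where "\<iota> C = ?k (SOME c. c \<in> M \<and> hat U M c = C)" for C
  have \<iota>: "\<iota> (hat U M c) = ?k c" if "c \<in> M" for c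
  proof -
    have "(SOME d. d \<in> M \<and> hat U M d = hat U M c) \<in> M \<and>
        hat U M (SOME d. d \<in> M \<and> hat U M d = hat U M c) = hat U M c"
      using that by (rule_tac someI[of "\<lambda>d. d \<in> M \<and> hat U M d = hat U M c"]) auto
    then show ?thesis
      unfolding \<iota>_def using eq_iff that by blast
  qed
  have "?k ` M = {F \<in> carrier (Mhat_fun U M \<Omega>). grad_hat U M \<Omega> F = (\<chi> j. \<zero>\<^bsub>Mhat_fun U M \<Omega>\<^esub>)}"
  proof (intro equalityI subsetI)
    fix F assume "F \<in> ?k ` M"
    then obtain c where c: "c \<in> M" "F = ?k c"
      by blast
    then obtain s where s: "c = star_class U s"
      using M_star by blast
    have "grad_hat U M \<Omega> F = (\<chi> j. \<zero>\<^bsub>Mhat_fun U M \<Omega>\<^esub>)"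
      unfolding c s const_fun_class grad_hat_zero_iff[OF smooth_const]
      by (simp add: pds_const_nearstandard N_zero)
    then show "F \<in> {F \<in> carrier (Mhat_fun U M \<Omega>). grad_hat U M \<Omega> F = (\<chi> j. \<zero>\<^bsub>Mhat_fun U M \<Omega>\<^esub>)}"
      using in_M_fun[OF c(1)] by (auto simp: Mhat_fun c)
  next
    fix F assume F: "F \<in> {F \<in> carrier (Mhat_fun U M \<Omega>). grad_hat U M \<Omega> F = (\<chi> j. \<zero>\<^bsub>Mhat_fun U M \<Omega>\<^esub>)}"
    then obtain f where fM: "star_class U f \<in> M_fun U M \<Omega>" "F = hat_fun U M \<Omega> (star_class U f)"
        and f: "\<And>i. f i \<in> smooth_funs \<Omega>"
      unfolding Mhat_fun using fun_extD by blast
    have der: "N (\<lambda>i. pds js (f i) (x i))" if "js \<noteq> []" "nearstandard U \<Omega> x" for js x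
      using F that unfolding fM(2) mem_Collect_eq grad_hat_zero_iff[OF f] by blast
    obtain a where a: "a \<in> \<Omega>"
      using assms(2) by blast
    \<comment> \<open>The constant sought is the value of \<open>f\<close> at a standard point; it
      lies in \<open>M\<close> by the condition for the empty list.\<close>
    define s where "s = (\<lambda>i. f i a)"
    have "star_class U (\<lambda>i. pds [] (f i) a) \<in> M"
      using fM(1) nearstandard_const[OF a, of U] unfolding fun_ext_iff[OF open_\<Omega> f] by blast
    then have "star_class U s \<in> M"
      by (simp add: s_def)
    moreover have "F = ?k (star_class U s)"
      unfolding fM(2) const_fun_class hat_fun_eq_iff[OF f smooth_const]
    proof (intro allI impI)
      fix js x assume x: "nearstandard U \<Omega> x"
      have grad: "N (\<lambda>i. pd j (f i) (y i))" if "nearstandard U \<Omega> y" for j y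
        using der[of "[j]" y] that by simp
      \<comment> \<open>For the empty list this is the small oscillation of \<open>f\<close>; for
        all other lists it is the vanishing gradient.\<close>
      have N: "N (\<lambda>i. pds js (f i) (x i) - (if js = [] then s i else 0))"
        using der[OF _ x, of js] small_oscillation[OF f grad assms(1) a x]
        by (cases "js = []") (simp_all add: s_def)
      have "\<forall>\<^sub>F i in U. norm (pds js (f i) (x i) - pds js (\<lambda>x\<in>\<Omega>. s i) (x i)) =
          norm (pds js (f i) (x i) - (if js = [] then s i else 0))"
        using nearstandard_eventually[OF open_\<Omega> x] by eventually_elim (simp add: pds_restrict_const)
      from N_cong[OF this] N show "N (\<lambda>i. pds js (f i) (x i) - pds js (\<lambda>x\<in>\<Omega>. s i) (x i))"
        by blast
    qed
    ultimately show "F \<in> ?k ` M"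
      by blast
  qed
  moreover have "\<iota> ` carrier (Mhat U M) = ?k ` M"
    unfolding Mhat image_image using \<iota> by (rule image_cong[OF refl])
  moreover have "inj_on \<iota> (carrier (Mhat U M))"
    unfolding Mhat by (rule inj_onI) (auto simp: \<iota> eq_iff)
  ultimately show ?thesis
    using \<iota> in_M_fun by (intro exI[of _ \<iota>]) simp
qed

end

theorem corollary22p8:
  fixes U :: "'i filter" and M :: "('i \<Rightarrow> complex) set set" and \<Omega> :: "(real^'n) set"
  assumes "infinite (UNIV :: 'i set)"
    and "ultrafilter U"
    and "\<exists>A :: nat \<Rightarrow> 'i set. decseq A \<and> (\<forall>n. \<forall>\<^sub>F i in U. i \<in> A n) \<and> (\<Inter>n. A n) = {}"
    and "uncountable (UNIV :: 'i set) \<longrightarrow> good_filter (UNIV :: 'i set) U"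
    and "convex_subring U M"
    and "open \<Omega>" and "path_connected \<Omega>" and "\<Omega> \<noteq> {}"
  shows "(\<exists>\<iota>. (\<forall>c\<in>M. const_fun U \<Omega> c \<in> M_fun U M \<Omega> \<and>
                      \<iota> (hat U M c) = hat_fun U M \<Omega> (const_fun U \<Omega> c)) \<and>
              inj_on \<iota> (carrier (Mhat U M)) \<and>
              \<iota> ` carrier (Mhat U M) =
                {F \<in> carrier (Mhat_fun U M \<Omega>).
                  grad_hat U M \<Omega> F = (\<chi> j. \<zero>\<^bsub>Mhat_fun U M \<Omega>\<^esub>)}) \<and>
         (\<exists>\<iota>. (\<forall>c\<in>M. const_fun U (UNIV :: (real^'n) set) c \<in> M_fun U M UNIV \<and>
                      \<iota> (hat U M c) = hat_fun U M UNIV (const_fun U (UNIV :: (real^'n) set) c)) \<and>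
              inj_on \<iota> (carrier (Mhat U M)) \<and>
              \<iota> ` carrier (Mhat U M) =
                {F \<in> carrier (Mhat_fun U M (UNIV :: (real^'n) set)).
                  grad_hat U M UNIV F = (\<chi> j. \<zero>\<^bsub>Mhat_fun U M (UNIV :: (real^'n) set)\<^esub>)})"
proof
  \<comment> \<open>Both halves are instances of \<open>Mhat_eq_zero_gradient\<close>, for
    \<open>\<Omega>\<close> and for the whole space; arcwise connectedness enters through
    connectedness.\<close>
  interpret \<Omega>: generalized_functions U M \<Omega>
    by unfold_locales (fact assms)+
  interpret UNIV: generalized_functions U M "UNIV :: (real^'n) set"
    by unfold_locales (fact open_UNIV)
  show "\<exists>\<iota>. (\<forall>c\<in>M. const_fun U \<Omega> c \<in> M_fun U M \<Omega> \<and>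
                      \<iota> (hat U M c) = hat_fun U M \<Omega> (const_fun U \<Omega> c)) \<and>
              inj_on \<iota> (carrier (Mhat U M)) \<and>
              \<iota> ` carrier (Mhat U M) =
                {F \<in> carrier (Mhat_fun U M \<Omega>).
                  grad_hat U M \<Omega> F = (\<chi> j. \<zero>\<^bsub>Mhat_fun U M \<Omega>\<^esub>)}"
    using assms(7,8) by (intro \<Omega>.Mhat_eq_zero_gradient path_connected_imp_connected)
  show "\<exists>\<iota>. (\<forall>c\<in>M. const_fun U (UNIV :: (real^'n) set) c \<in> M_fun U M UNIV \<and>
                      \<iota> (hat U M c) = hat_fun U M UNIV (const_fun U (UNIV :: (real^'n) set) c)) \<and>
              inj_on \<iota> (carrier (Mhat U M)) \<and>
              \<iota> ` carrier (Mhat U M) =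
                {F \<in> carrier (Mhat_fun U M (UNIV :: (real^'n) set)).
                  grad_hat U M UNIV F = (\<chi> j. \<zero>\<^bsub>Mhat_fun U M (UNIV :: (real^'n) set)\<^esub>)}"
    by (rule UNIV.Mhat_eq_zero_gradient) auto
qed

end
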